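(* Let $\alpha\in(1,2)$ and let $J$ be a symmetric real random variable with $\mathbb{E}[|J|]<\infty$ such that, for some constant $C_0>0$, $\mathbb{P}(|J|\ge t)=C_0t^{-\alpha}$ for all $t>1$. For each $N$ let $\{J_{ij}\}_{1\le i<j\le N}$ be independent random variables with the same distribution as $J$, and for $\beta>0$ set $$H(\sigma)=\frac1{N^{1/\alpha}}\sum_{1\le i<j\le N}J_{ij}\sigma_i\sigma_j\quad(\sigma\in\{-1,+1\}^N),\qquad Z_N(\beta)=\sum_{\sigma\in\{-1,+1\}^N}e^{\beta H(\sigma)},\qquad F_N(\beta)=\frac1N\mathbb{E}\big[\log Z_N(\beta)\big].$$ Then for every $\beta>0$ the limit $\lim_{N\to\infty}F_N(\beta)$ exists and is finite.
   Context: A random variable $J$ is symmetric if $J$ and $-J$ have the same distribution. *)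

theory Defs
  imports "HOL-Probability.Probability"
begin

definition symmetric_rv :: "'a measure \<Rightarrow> ('a \<Rightarrow> real) \<Rightarrow> bool" where
  "symmetric_rv M X \<longleftrightarrow> distr M borel X = distr M borel (\<lambda>\<omega>. - X \<omega>)"

definition edges :: "nat \<Rightarrow> (nat \<times> nat) set" where
  "edges N = {(i, j). 1 \<le> i \<and> i < j \<and> j \<le> N}"

text \<open>Elements of the extensional function space \<open>spins N\<close> are in bijection with
  \<open>{-1, 1}\<close>-valued vectors indexed by \<open>{1..N}\<close>, so sums over it count each configuration once.\<close>

definition spins :: "nat \<Rightarrow> (nat \<Rightarrow> real) set" where
  "spins N = {1..N} \<rightarrow>\<^sub>E {-1, 1}"

definition hamiltonian :: "real \<Rightarrow> nat \<Rightarrow> (nat \<times> nat \<Rightarrow> real) \<Rightarrow> (nat \<Rightarrow> real) \<Rightarrow> real" where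
  "hamiltonian \<alpha> N g \<sigma> =
     1 / real N powr (1 / \<alpha>) * (\<Sum>(i, j)\<in>edges N. g (i, j) * \<sigma> i * \<sigma> j)"

definition partition_function :: "real \<Rightarrow> nat \<Rightarrow> (nat \<times> nat \<Rightarrow> real) \<Rightarrow> real \<Rightarrow> real" where
  "partition_function \<alpha> N g \<beta> = (\<Sum>\<sigma>\<in>spins N. exp (\<beta> * hamiltonian \<alpha> N g \<sigma>))"

text \<open>If the couplings are integrable, so is the logarithm below, since \<open>\<bar>ln Z\<bar>\<close> is at most
  \<open>N ln 2 + \<bar>\<beta>\<bar> N powr (-1/\<alpha>) \<Sum> \<bar>J\<^sub>i\<^sub>j\<bar>\<close>; the Bochner integral is then a genuine expectation.\<close>

definition free_energy ::
    "real \<Rightarrow> nat \<Rightarrow> 'a measure \<Rightarrow> (nat \<times> nat \<Rightarrow> 'a \<Rightarrow> real) \<Rightarrow> real \<Rightarrow> real" where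
  "free_energy \<alpha> N M J \<beta> =
     1 / real N * (\<integral>\<omega>. ln (partition_function \<alpha> N (\<lambda>e. J e \<omega>) \<beta>) \<partial>M)"

end

theory Submission
  imports Defs "HOL-Real_Asymp.Real_Asymp"
begin

text \<open>
  The couplings are heavy-tailed, and after division by \<open>N powr (1 / \<alpha>)\<close> a coupling exceeds a
  fixed level \<open>\<epsilon>\<close> with probability of order \<open>1 / N\<close>. So the strong couplings form a sparse
  random graph with bounded mean degree, and since the tail is an exact power law, the law of a
  strong coupling is the same for all large \<open>N\<close>. The proof reduces the model to this sparse one
  and lets \<open>\<epsilon>\<close> tend to zero.

  Everything rests on the effect of one bond. If a symmetric coupling \<open>y\<close> is added between spins
  whose correlation without it is \<open>m\<close>, the mean log-partition function increases by the
  expectation of \<open>gain y m = ln (1 + (1 - m\<^sup>2) * (sinh y)\<^sup>2) / 2\<close> (\<open>quenched_insert\<close>). This is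
  nonnegative and bounded both by \<open>\<bar>y\<bar>\<close> and by \<open>y\<^sup>2 / 2\<close>.

  The quadratic bound disposes of the weak couplings. Below the level \<open>\<epsilon> * N powr (1 / \<alpha>)\<close> the
  truncated second moment of a normalized coupling is of order \<open>\<epsilon> powr (2 - \<alpha>) / N\<close>; exchanging
  the roughly \<open>N\<^sup>2 / 2\<close> edges one at a time (\<open>thin_quenched_compare\<close>) therefore changes the free
  energy per site by a quantity of order \<open>\<epsilon> powr (2 - \<alpha>)\<close>, uniformly for large \<open>N\<close>
  (\<open>quenched_coupling_approx\<close>). As \<open>\<alpha> < 2\<close>, this is small with \<open>\<epsilon>\<close>.

  The sparse model has a limit because its log-partition function is superadditive up to a
  constant (\<open>sparse_energy_superadditive\<close>, in the manner of Guerra, Franz and Leone). Move the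
  edge probabilities linearly from the joint system on \<open>n1 + n2\<close> sites to two separate systems
  on \<open>n1\<close> and \<open>n2\<close> sites. Up to a bounded error, the derivative is a quadratic form in the
  matrix of gains, evaluated at a vector with zero sum. The gain is a constant minus a power
  series with nonnegative coefficients in the entries of the positive semidefinite correlation
  matrix, so by the Schur product theorem the form is nonpositive (\<open>gain_negative_type\<close>), and
  the joint system has the larger mean log-partition function. Fekete's lemma
  (\<open>almost_superadditive_converges\<close>) gives the limit for each \<open>\<epsilon>\<close>. The free energy is thus
  approximated to any accuracy by convergent sequences, hence is Cauchy.
\<close>

section \<open>Independent thinning of a finite set\<close>

text \<open>
  The expectation of \<open>\<Phi> S\<close> over a random subset \<open>S\<close> of \<open>E\<close> that retains each \<open>e\<close> independently
  with probability \<open>p e\<close>. As an explicit finite sum it is a polynomial in the numbers \<open>p e\<close>, so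
  it can be differentiated along a path of retention probabilities.
\<close>
definition thin :: "'e set \<Rightarrow> ('e \<Rightarrow> real) \<Rightarrow> ('e set \<Rightarrow> real) \<Rightarrow> real" where
  "thin E p \<Phi> = (\<Sum>S\<in>Pow E. (\<Prod>e\<in>E. if e \<in> S then p e else 1 - p e) * \<Phi> S)"

lemma thin_empty [simp]: "thin {} p \<Phi> = \<Phi> {}"
  by (simp add: thin_def)

text \<open>
  Condition on whether \<open>e\<close> is retained. This recursion is the working form of the definition:
  inductions on \<open>E\<close> go through it.
\<close>
lemma thin_insert:
  assumes "finite E" "e \<notin> E"
  shows "thin (insert e E) p \<Phi> = (1 - p e) * thin E p \<Phi> + p e * thin E p (\<lambda>S. \<Phi> (insert e S))"
proof -
  let ?w = "\<lambda>E S. \<Prod>e\<in>E. if e \<in> S then p e else 1 - p e"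
  have inj: "inj_on (insert e) (Pow E)"
    using assms(2) by (auto simp: inj_on_def)
  have disj: "Pow E \<inter> insert e ` Pow E = {}"
    using assms(2) by auto
  have w0: "?w (insert e E) S = (1 - p e) * ?w E S" if "S \<in> Pow E" for S
    using that assms by auto
  have w1: "?w (insert e E) (insert e S) = p e * ?w E S" for S
  proof -
    have "?w E (insert e S) = ?w E S"
      using assms(2) by (intro prod.cong) auto
    then show ?thesis using assms by simp
  qed
  have "thin (insert e E) p \<Phi> = (\<Sum>S\<in>Pow E. ?w (insert e E) S * \<Phi> S)
      + (\<Sum>S\<in>insert e ` Pow E. ?w (insert e E) S * \<Phi> S)"
    unfolding thin_def Pow_insert using assms(1) disj by (intro sum.union_disjoint) auto
  also have "(\<Sum>S\<in>Pow E. ?w (insert e E) S * \<Phi> S) = (1 - p e) * thin E p \<Phi>"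
    unfolding thin_def sum_distrib_left by (intro sum.cong) (simp_all only: w0 mult.assoc)
  also have "(\<Sum>S\<in>insert e ` Pow E. ?w (insert e E) S * \<Phi> S) = p e * thin E p (\<lambda>S. \<Phi> (insert e S))"
    unfolding thin_def sum_distrib_left sum.reindex[OF inj] o_def
    by (intro sum.cong) (simp_all only: w1 mult.assoc)
  finally show ?thesis .
qed

lemma thin_cong:
  assumes "\<And>e. e \<in> E \<Longrightarrow> p e = q e" "\<And>S. S \<subseteq> E \<Longrightarrow> \<Phi> S = \<Psi> S"
  shows "thin E p \<Phi> = thin E q \<Psi>"
  unfolding thin_def using assms by (auto intro!: sum.cong prod.cong)

lemma thin_add: "thin E p (\<lambda>S. \<Phi> S + \<Psi> S) = thin E p \<Phi> + thin E p \<Psi>"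
  by (simp add: thin_def algebra_simps sum.distrib)

lemma thin_cmult: "thin E p (\<lambda>S. c * \<Phi> S) = c * thin E p \<Phi>"
  by (simp add: thin_def algebra_simps sum_distrib_left)

lemma thin_diff: "thin E p (\<lambda>S. \<Phi> S - \<Psi> S) = thin E p \<Phi> - thin E p \<Psi>"
  by (simp add: thin_def algebra_simps sum_subtractf)

lemma thin_sum: "thin E p (\<lambda>S. \<Sum>i\<in>I. \<Phi> i S) = (\<Sum>i\<in>I. thin E p (\<Phi> i))"
  unfolding thin_def sum_distrib_left by (rule sum.swap)

lemma thin_const: "finite E \<Longrightarrow> thin E p (\<lambda>_. c) = c"
  by (induction E rule: finite_induct) (simp_all add: thin_insert algebra_simps)

lemma thin_mono:
  assumes "\<And>e. e \<in> E \<Longrightarrow> 0 \<le> p e \<and> p e \<le> 1" "\<And>S. S \<subseteq> E \<Longrightarrow> \<Phi> S \<le> \<Psi> S"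
  shows "thin E p \<Phi> \<le> thin E p \<Psi>"
  unfolding thin_def using assms
  by (intro sum_mono mult_left_mono prod_nonneg) auto

lemma thin_Int:
  "finite E \<Longrightarrow> thin E p (\<lambda>S. \<Phi> (S \<inter> F)) = thin (E \<inter> F) p \<Phi>"
proof (induction E arbitrary: \<Phi> rule: finite_induct)
  case (insert e E)
  show ?case
  proof (cases "e \<in> F")
    case True
    have "thin E p (\<lambda>S. \<Phi> (insert e S \<inter> F)) = thin (E \<inter> F) p (\<lambda>S. \<Phi> (insert e S))"
      using insert.IH[of "\<lambda>S. \<Phi> (insert e S)"] True by (simp add: Int_insert_left)
    then show ?thesis
      using insert True by (simp add: thin_insert Int_insert_left)
  next
    case False
    then show ?thesis
      using insert by (simp add: thin_insert Int_insert_left algebra_simps)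
  qed
qed simp

lemma thin_support:
  "finite E \<Longrightarrow> thin E p \<Phi> = thin {e \<in> E. p e \<noteq> 0} p \<Phi>"
proof (induction E arbitrary: \<Phi> rule: finite_induct)
  case (insert e E)
  have "{x \<in> insert e E. p x \<noteq> 0} =
      (if p e = 0 then {x \<in> E. p x \<noteq> 0} else insert e {x \<in> E. p x \<noteq> 0})"
    by auto
  then show ?case
    using insert by (simp add: thin_insert flip: insert.IH)
qed simp

lemma thin_one:
  "finite E \<Longrightarrow> (\<And>e. e \<in> E \<Longrightarrow> p e = 1) \<Longrightarrow> thin E p \<Phi> = \<Phi> E"
  by (induction E arbitrary: \<Phi> rule: finite_induct) (simp_all add: thin_insert)

lemma thin_image:
  "finite E \<Longrightarrow> inj_on \<phi> E \<Longrightarrow> thin (\<phi> ` E) p \<Phi> = thin E (p \<circ> \<phi>) (\<lambda>S. \<Phi> (\<phi> ` S))"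
  by (induction E arbitrary: \<Phi> rule: finite_induct) (simp_all add: thin_insert)

text \<open>
  The Margulis-Russo formula: the expectation is affine in each retention probability, and its
  slope in \<open>p e\<close> is the mean effect of adding \<open>e\<close> to a random subset of the other elements.
\<close>
lemma thin_has_derivative:
  assumes "finite E"
    and "\<And>e. e \<in> E \<Longrightarrow> ((\<lambda>t. p t e) has_real_derivative p' e) (at t)"
  shows "((\<lambda>t. thin E (p t) \<Phi>) has_real_derivative
     (\<Sum>e\<in>E. p' e * thin (E - {e}) (p t) (\<lambda>S. \<Phi> (insert e S) - \<Phi> S))) (at t)"
  using assms
proof (induction E arbitrary: \<Phi> rule: finite_induct)
  case empty
  then show ?case by simp
next
  case (insert a E)
  let ?D = "\<lambda>\<Phi>. \<Sum>e\<in>E. p' e * thin (E - {e}) (p t) (\<lambda>S. \<Phi> (insert e S) - \<Phi> S)"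
  have IH: "((\<lambda>t. thin E (p t) \<Phi>) has_real_derivative ?D \<Phi>) (at t)" for \<Phi>
    using insert.IH insert.prems by simp
  have 1: "p' e * thin (insert a E - {e}) (p t) (\<lambda>S. \<Phi> (insert e S) - \<Phi> S) =
     (1 - p t a) * (p' e * thin (E - {e}) (p t) (\<lambda>S. \<Phi> (insert e S) - \<Phi> S)) +
     p t a * (p' e * thin (E - {e}) (p t) (\<lambda>S. \<Phi> (insert a (insert e S)) - \<Phi> (insert a S)))"
    if "e \<in> E" for e
  proof -
    have "insert a E - {e} = insert a (E - {e})" using that insert by auto
    then show ?thesis
      using insert by (simp add: thin_insert insert_commute algebra_simps)
  qed
  have D: "(\<Sum>e\<in>insert a E. p' e * thin (insert a E - {e}) (p t) (\<lambda>S. \<Phi> (insert e S) - \<Phi> S)) =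
     p' a * (thin E (p t) (\<lambda>S. \<Phi> (insert a S)) - thin E (p t) \<Phi>)
     + ((1 - p t a) * ?D \<Phi> + p t a * ?D (\<lambda>S. \<Phi> (insert a S)))"
  proof -
    let ?g = "\<lambda>e. p' e * thin (insert a E - {e}) (p t) (\<lambda>S. \<Phi> (insert e S) - \<Phi> S)"
    have "insert a E - {a} = E" using insert by auto
    then have "sum ?g (insert a E) =
        p' a * (thin E (p t) (\<lambda>S. \<Phi> (insert a S)) - thin E (p t) \<Phi>) + sum ?g E"
      using insert.hyps by (simp add: thin_diff)
    moreover have "sum ?g E = (\<Sum>e\<in>E.
      (1 - p t a) * (p' e * thin (E - {e}) (p t) (\<lambda>S. \<Phi> (insert e S) - \<Phi> S)) +
      p t a * (p' e * thin (E - {e}) (p t) (\<lambda>S. \<Phi> (insert a (insert e S)) - \<Phi> (insert a S))))"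
      by (rule sum.cong[OF refl 1])
    ultimately show ?thesis
      by (simp only: sum.distrib sum_distrib_left insert_commute)
  qed
  have "((\<lambda>t. (1 - p t a) * thin E (p t) \<Phi> + p t a * thin E (p t) (\<lambda>S. \<Phi> (insert a S)))
     has_real_derivative
      (- p' a * thin E (p t) \<Phi> + (1 - p t a) * ?D \<Phi>
       + (p' a * thin E (p t) (\<lambda>S. \<Phi> (insert a S)) + p t a * ?D (\<lambda>S. \<Phi> (insert a S))))) (at t)"
    by (rule derivative_eq_intros IH insert.prems[OF insertI1] refl | simp)+
  then show ?case
    unfolding D thin_insert[OF insert.hyps(1,2)] by (simp add: algebra_simps)
qed

section \<open>The effect of one symmetric bond\<close>

text \<open>
  The Schur product theorem for entrywise powers of a Gram matrix. One factor of the matrix is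
  expanded over \<open>c\<close>, and \<open>s c i\<close> is absorbed into the test vector, which leaves a nonnegative
  combination of quadratic forms of the previous power. In physical terms the \<open>n\<close>-th power is a
  correlation of \<open>n\<close> replicas.
\<close>
lemma gram_power_nonneg:
  fixes s :: "'c \<Rightarrow> 'v \<Rightarrow> real" and w :: "'c \<Rightarrow> real" and u :: "'v \<Rightarrow> real"
  assumes "\<And>c. c \<in> C \<Longrightarrow> 0 \<le> w c"
  shows "0 \<le> (\<Sum>i\<in>V. \<Sum>j\<in>V. u i * u j * (\<Sum>c\<in>C. w c * s c i * s c j) ^ n)"
proof (induction n arbitrary: u)
  case 0
  have "(\<Sum>i\<in>V. \<Sum>j\<in>V. u i * u j) = (\<Sum>i\<in>V. u i)\<^sup>2"
    by (simp add: sum_product power2_eq_square)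
  then show ?case by simp
next
  case (Suc n)
  let ?m = "\<lambda>i j. \<Sum>c\<in>C. w c * s c i * s c j"
  have "(\<Sum>i\<in>V. \<Sum>j\<in>V. u i * u j * ?m i j ^ Suc n)
      = (\<Sum>i\<in>V. \<Sum>j\<in>V. \<Sum>c\<in>C. w c * ((u i * s c i) * (u j * s c j) * ?m i j ^ n))"
    by (simp add: sum_distrib_left sum_distrib_right algebra_simps)
  also have "\<dots> = (\<Sum>c\<in>C. w c * (\<Sum>i\<in>V. \<Sum>j\<in>V. (u i * s c i) * (u j * s c j) * ?m i j ^ n))"
    by (simp only: sum.swap[of _ C V] sum_distrib_left)
  also have "\<dots> \<ge> 0"
    by (intro sum_nonneg[of C] mult_nonneg_nonneg Suc.IH assms)
  finally show ?case .
qed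

text \<open>
  Adding a bond of strength \<open>y\<close> between spins with correlation \<open>m\<close> multiplies the partition
  function by \<open>cosh y + m * sinh y\<close>. The gain is the logarithm of this factor averaged over the
  sign of \<open>y\<close>; see \<open>gain_symmetrization\<close>.
\<close>
definition gain :: "real \<Rightarrow> real \<Rightarrow> real" where
  "gain y m = 1 / 2 * ln (1 + (1 - m\<^sup>2) * (sinh y)\<^sup>2)"

lemma sinh_cosh_measurable [measurable]:
  fixes f :: "'a \<Rightarrow> real"
  assumes [measurable]: "f \<in> borel_measurable M"
  shows "(\<lambda>x. sinh (f x)) \<in> borel_measurable M" "(\<lambda>x. cosh (f x)) \<in> borel_measurable M"
  by (auto intro!: measurable_compose[OF assms] borel_measurable_continuous_onI continuous_intros)

lemma gain_measurable [measurable]: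
  assumes [measurable]: "f \<in> borel_measurable M" "g \<in> borel_measurable M"
  shows "(\<lambda>x. gain (f x) (g x)) \<in> borel_measurable M"
  unfolding gain_def by measurable

lemma gain_minus [simp]: "gain (- y) m = gain y m"
  by (simp add: gain_def)

lemma gain_one [simp]: "gain y 1 = 0"
  by (simp add: gain_def)

lemma gain_nonneg: "\<bar>m\<bar> \<le> 1 \<Longrightarrow> 0 \<le> gain y m"
  by (simp add: gain_def abs_square_le_1)

lemma gain_le_ln_cosh:
  assumes "\<bar>m\<bar> \<le> 1"
  shows "gain y m \<le> ln (cosh y)"
proof -
  have "(1 - m\<^sup>2) * (sinh y)\<^sup>2 \<le> 1 * (sinh y)\<^sup>2"
    by (intro mult_right_mono) auto
  then have "1 + (1 - m\<^sup>2) * (sinh y)\<^sup>2 \<le> (cosh y)\<^sup>2"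
    by (simp add: cosh_square_eq)
  moreover have "0 < 1 + (1 - m\<^sup>2) * (sinh y)\<^sup>2"
    using assms by (intro add_pos_nonneg mult_nonneg_nonneg) (auto simp: abs_square_le_1)
  ultimately have "ln (1 + (1 - m\<^sup>2) * (sinh y)\<^sup>2) \<le> ln ((cosh y)\<^sup>2)"
    by simp
  then show ?thesis
    by (simp add: gain_def ln_realpow)
qed

lemma cosh_le_exp_abs: "cosh (y::real) \<le> exp \<bar>y\<bar>"
  by (cases "0 \<le> y") (auto simp: cosh_field_def)

lemma gain_le_abs:
  assumes "\<bar>m\<bar> \<le> 1"
  shows "gain y m \<le> \<bar>y\<bar>"
proof -
  have "ln (cosh y) \<le> ln (exp \<bar>y\<bar>)"
    using cosh_le_exp_abs by (subst ln_le_cancel_iff) auto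
  then show ?thesis using gain_le_ln_cosh[OF assms, of y] by simp
qed

text \<open>
  The difference of the two sides has derivative \<open>y - tanh y\<close>, which is nonnegative for \<open>y \<ge> 0\<close>;
  both sides are even. This quadratic bound makes weak bonds negligible once their second moment
  is small.
\<close>
lemma ln_cosh_le: "ln (cosh (y::real)) \<le> y\<^sup>2 / 2"
proof -
  have tanh_le: "tanh x \<le> x" if "0 \<le> x" for x :: real
  proof -
    have "0 - tanh 0 \<le> x - tanh x"
      by (rule deriv_nonneg_imp_mono[where g' = "\<lambda>x. (tanh x)\<^sup>2"])
         (use that in \<open>auto intro!: derivative_eq_intros\<close>)
    then show ?thesis by simp
  qed
  have "0\<^sup>2 / 2 - ln (cosh 0) \<le> \<bar>y\<bar>\<^sup>2 / 2 - ln (cosh \<bar>y\<bar>)"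
    by (rule deriv_nonneg_imp_mono[where g = "\<lambda>x. x\<^sup>2 / 2 - ln (cosh x)" and g' = "\<lambda>x. x - tanh x"])
       (auto intro!: derivative_eq_intros simp: tanh_le[unfolded tanh_def] tanh_def)
  then show ?thesis by simp
qed

lemma gain_le_square: "\<bar>m\<bar> \<le> 1 \<Longrightarrow> gain y m \<le> y\<^sup>2 / 2"
  using gain_le_ln_cosh ln_cosh_le order_trans by blast

text \<open>
  \<open>cosh y + m * sinh y\<close> is the convex combination of \<open>exp y\<close> and \<open>exp (- y)\<close> with weights
  \<open>(1 + m) / 2\<close> and \<open>(1 - m) / 2\<close>.
\<close>
lemma cosh_plus_mult_sinh_bounds:
  fixes y m :: real
  assumes "\<bar>m\<bar> \<le> 1"
  shows "exp (- \<bar>y\<bar>) \<le> cosh y + m * sinh y" "cosh y + m * sinh y \<le> exp \<bar>y\<bar>"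
proof -
  have c: "cosh y = (1 + m) / 2 * exp y + (1 - m) / 2 * exp (- y) - m * sinh y"
    by (simp add: cosh_field_def sinh_field_def field_simps)
  have *: "exp (- \<bar>y\<bar>) \<le> exp y" "exp (- \<bar>y\<bar>) \<le> exp (- y)" "exp y \<le> exp \<bar>y\<bar>" "exp (- y) \<le> exp \<bar>y\<bar>"
    by auto
  have m: "0 \<le> (1 + m) / 2" "0 \<le> (1 - m) / 2" using assms by auto
  have "exp (- \<bar>y\<bar>) = (1 + m) / 2 * exp (- \<bar>y\<bar>) + (1 - m) / 2 * exp (- \<bar>y\<bar>)"
    by (simp add: field_simps)
  also have "\<dots> \<le> (1 + m) / 2 * exp y + (1 - m) / 2 * exp (- y)"
    by (intro add_mono mult_left_mono * m)
  finally show "exp (- \<bar>y\<bar>) \<le> cosh y + m * sinh y" using c by simp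
  have "(1 + m) / 2 * exp y + (1 - m) / 2 * exp (- y) \<le>
     (1 + m) / 2 * exp \<bar>y\<bar> + (1 - m) / 2 * exp \<bar>y\<bar>"
    by (intro add_mono mult_left_mono * m)
  also have "\<dots> = exp \<bar>y\<bar>" by (simp add: field_simps)
  finally show "cosh y + m * sinh y \<le> exp \<bar>y\<bar>" using c by simp
qed

lemma cosh_plus_mult_sinh_pos: "\<bar>m\<bar> \<le> 1 \<Longrightarrow> 0 < cosh y + m * sinh (y::real)"
  using cosh_plus_mult_sinh_bounds(1)[of m y] exp_gt_zero[of "-\<bar>y\<bar>"] by linarith

lemma abs_ln_cosh_plus_mult_sinh_le:
  fixes y m :: real
  assumes "\<bar>m\<bar> \<le> 1"
  shows "\<bar>ln (cosh y + m * sinh y)\<bar> \<le> \<bar>y\<bar>"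
proof -
  note b = cosh_plus_mult_sinh_bounds[OF assms, of y] cosh_plus_mult_sinh_pos[OF assms, of y]
  have "ln (exp (- \<bar>y\<bar>)) \<le> ln (cosh y + m * sinh y)" "ln (cosh y + m * sinh y) \<le> ln (exp \<bar>y\<bar>)"
    using b by (simp_all only: ln_le_cancel_iff exp_gt_zero)
  then show ?thesis by simp
qed

lemma gain_symmetrization:
  assumes "\<bar>m\<bar> \<le> 1"
  shows "gain y m = (ln (cosh y + m * sinh y) + ln (cosh (- y) + m * sinh (- y))) / 2"
proof -
  have pos: "0 < cosh y + m * sinh y" "0 < cosh (-y) + m * sinh (-y)"
    using cosh_plus_mult_sinh_pos[OF assms] by blast+
  have "1 + (1 - m\<^sup>2) * (sinh y)\<^sup>2 = (cosh y + m * sinh y) * (cosh (-y) + m * sinh (-y))"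
    using cosh_square_eq[of y] by (simp add: algebra_simps power2_eq_square)
  then show ?thesis
    using pos by (simp add: gain_def ln_mult)
qed

text \<open>
  With \<open>\<theta> = (tanh y)\<^sup>2\<close> the gain is \<open>ln (cosh y) + ln (1 - \<theta> * m\<^sup>2) / 2\<close>. The first term is
  annihilated by \<open>v\<close>, whose entries sum to zero. The second is a power series in \<open>m\<close> with
  nonpositive coefficients, so positivity of all entrywise powers of the correlation matrix
  gives the sign. This is the convexity that decides the direction of the interpolation between
  systems.
\<close>
lemma gain_negative_type:
  fixes m :: "'v \<Rightarrow> 'v \<Rightarrow> real" and v :: "'v \<Rightarrow> real"
  assumes psd: "\<And>n. 0 \<le> (\<Sum>i\<in>V. \<Sum>j\<in>V. v i * v j * m i j ^ n)"
    and m: "\<And>i j. i \<in> V \<Longrightarrow> j \<in> V \<Longrightarrow> \<bar>m i j\<bar> \<le> 1"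
    and v: "(\<Sum>i\<in>V. v i) = 0"
  shows "(\<Sum>i\<in>V. \<Sum>j\<in>V. v i * v j * gain y (m i j)) \<le> 0"
proof -
  define \<theta> where "\<theta> = (tanh y)\<^sup>2"
  have \<theta>: "0 \<le> \<theta>" "\<theta> < 1"
    using tanh_real_bounds[of y] by (auto simp: \<theta>_def abs_square_less_1)
  have z: "\<bar>- (\<theta> * (m i j)\<^sup>2)\<bar> < 1" if "i \<in> V" "j \<in> V" for i j
  proof -
    have "\<theta> * (m i j)\<^sup>2 \<le> \<theta> * 1"
      using m[OF that] \<theta> by (intro mult_left_mono) (auto simp: abs_square_le_1)
    then show ?thesis using \<theta> by simp
  qed
  have gain: "gain y (m i j) = ln (cosh y) + 1 / 2 * ln (1 + - (\<theta> * (m i j)\<^sup>2))"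
    if "i \<in> V" "j \<in> V" for i j
  proof -
    have "(cosh y)\<^sup>2 * \<theta> = (sinh y)\<^sup>2"
      by (simp add: \<theta>_def tanh_def power_divide)
    then have "1 + (1 - (m i j)\<^sup>2) * (sinh y)\<^sup>2 = (cosh y)\<^sup>2 * (1 + - (\<theta> * (m i j)\<^sup>2))"
      by (simp add: right_diff_distrib left_diff_distrib cosh_square_eq flip: mult.assoc)
    then show ?thesis
      using z[OF that] by (simp add: gain_def ln_mult ln_realpow)
  qed
  have ln: "(\<lambda>n. v i * v j * (- ((\<theta> * (m i j)\<^sup>2) ^ n) / of_nat n)) sums
      (v i * v j * ln (1 + - (\<theta> * (m i j)\<^sup>2)))" if "i \<in> V" "j \<in> V" for i j
    using ln_series'[OF z[OF that]] by (intro sums_mult) simp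
  have sums: "(\<lambda>n. \<Sum>i\<in>V. \<Sum>j\<in>V. v i * v j * (- ((\<theta> * (m i j)\<^sup>2) ^ n) / of_nat n)) sums
      (\<Sum>i\<in>V. \<Sum>j\<in>V. v i * v j * ln (1 + - (\<theta> * (m i j)\<^sup>2)))"
    by (intro sums_sum ln)
  have "(\<Sum>i\<in>V. \<Sum>j\<in>V. v i * v j * (- ((\<theta> * (m i j)\<^sup>2) ^ n) / of_nat n)) \<le> 0" for n
  proof -
    have "(\<Sum>i\<in>V. \<Sum>j\<in>V. v i * v j * (- ((\<theta> * (m i j)\<^sup>2) ^ n) / of_nat n))
       = - (\<theta> ^ n / of_nat n * (\<Sum>i\<in>V. \<Sum>j\<in>V. v i * v j * m i j ^ (2 * n)))"
      by (simp add: sum_distrib_left sum_negf[symmetric] power_mult_distrib algebra_simps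
          flip: power_mult)
    then show ?thesis
      using psd[of "2 * n"] \<theta> by simp
  qed
  then have "(\<Sum>i\<in>V. \<Sum>j\<in>V. v i * v j * ln (1 + - (\<theta> * (m i j)\<^sup>2))) \<le> 0"
    using sums_le[OF _ sums sums_zero] by simp
  moreover have "(\<Sum>i\<in>V. \<Sum>j\<in>V. v i * v j * gain y (m i j))
     = ln (cosh y) * (\<Sum>i\<in>V. v i)\<^sup>2 +
       1 / 2 * (\<Sum>i\<in>V. \<Sum>j\<in>V. v i * v j * ln (1 + - (\<theta> * (m i j)\<^sup>2)))"
    by (simp add: gain sum_product power2_eq_square sum_distrib_left sum.distrib[symmetric]
        algebra_simps cong: sum.cong)
  ultimately show ?thesis by (simp add: v)
qed

section \<open>Ising partition functions with given couplings\<close>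

definition configs :: "'v set \<Rightarrow> ('v \<Rightarrow> real) set" where
  "configs V = V \<rightarrow>\<^sub>E {-1, 1}"

text \<open>
  The inverse temperature and the normalization of the Hamiltonian are absorbed in the couplings
  \<open>x\<close>, and only the bonds in \<open>S\<close> are switched on.
\<close>
definition boltzmann :: "('v \<times> 'v) set \<Rightarrow> ('v \<times> 'v \<Rightarrow> real) \<Rightarrow> ('v \<Rightarrow> real) \<Rightarrow> real" where
  "boltzmann S x \<sigma> = exp (\<Sum>e\<in>S. x e * \<sigma> (fst e) * \<sigma> (snd e))"

definition gibbs_sum :: "'v set \<Rightarrow> ('v \<times> 'v) set \<Rightarrow> ('v \<times> 'v \<Rightarrow> real) \<Rightarrow> real" where
  "gibbs_sum V S x = (\<Sum>\<sigma>\<in>configs V. boltzmann S x \<sigma>)"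

definition corr :: "'v set \<Rightarrow> ('v \<times> 'v) set \<Rightarrow> ('v \<times> 'v \<Rightarrow> real) \<Rightarrow> 'v \<Rightarrow> 'v \<Rightarrow> real" where
  "corr V S x i j = (\<Sum>\<sigma>\<in>configs V. boltzmann S x \<sigma> / gibbs_sum V S x * \<sigma> i * \<sigma> j)"

lemma finite_configs [simp]: "finite V \<Longrightarrow> finite (configs V)"
  by (simp add: configs_def finite_PiE)

lemma card_configs: "finite V \<Longrightarrow> card (configs V) = 2 ^ card V"
  by (simp add: configs_def card_PiE numeral_2_eq_2)

lemma configs_nonempty [simp]: "configs V \<noteq> {}"
  by (simp add: configs_def PiE_eq_empty_iff)

lemma configsD: "\<sigma> \<in> configs V \<Longrightarrow> i \<in> V \<Longrightarrow> \<sigma> i = -1 \<or> \<sigma> i = 1"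
  by (auto simp: configs_def)

lemma abs_configs: "\<sigma> \<in> configs V \<Longrightarrow> i \<in> V \<Longrightarrow> \<bar>\<sigma> i\<bar> = 1"
  using configsD by fastforce

lemma boltzmann_pos [simp]: "0 < boltzmann S x \<sigma>"
  by (simp add: boltzmann_def)

lemma gibbs_sum_pos: "finite V \<Longrightarrow> 0 < gibbs_sum V S x"
  unfolding gibbs_sum_def by (intro sum_pos) auto

lemma gibbs_sum_empty: "finite V \<Longrightarrow> gibbs_sum V {} x = 2 ^ card V"
  by (simp add: gibbs_sum_def boltzmann_def card_configs)

lemma abs_ln_gibbs_sum_le:
  assumes "finite V" "finite S" "S \<subseteq> V \<times> V"
  shows "\<bar>ln (gibbs_sum V S x)\<bar> \<le> card V * ln 2 + (\<Sum>e\<in>S. \<bar>x e\<bar>)"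
proof -
  let ?X = "\<Sum>e\<in>S. \<bar>x e\<bar>"
  have e: "\<bar>\<Sum>e\<in>S. x e * \<sigma> (fst e) * \<sigma> (snd e)\<bar> \<le> ?X" if "\<sigma> \<in> configs V" for \<sigma>
  proof -
    have "\<bar>\<Sum>e\<in>S. x e * \<sigma> (fst e) * \<sigma> (snd e)\<bar> \<le> (\<Sum>e\<in>S. \<bar>x e * \<sigma> (fst e) * \<sigma> (snd e)\<bar>)"
      by (rule sum_abs)
    also have "\<dots> = ?X"
      using assms(3) by (intro sum.cong) (auto simp: abs_mult abs_configs[OF that])
    finally show ?thesis .
  qed
  have ub: "gibbs_sum V S x \<le> 2 ^ card V * exp ?X"
    using sum_bounded_above[of "configs V" "boltzmann S x" "exp ?X"] e
    by (force simp: gibbs_sum_def card_configs assms boltzmann_def abs_le_iff)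
  have "2 ^ card V * exp (- ?X) \<le> gibbs_sum V S x"
    using sum_bounded_below[of "configs V" "exp (- ?X)" "boltzmann S x"] e
    by (force simp: gibbs_sum_def card_configs assms boltzmann_def abs_le_iff)
  moreover have "1 * exp (- ?X) \<le> 2 ^ card V * exp (- ?X)"
    by (intro mult_right_mono) auto
  ultimately have lb: "exp (- ?X) \<le> gibbs_sum V S x" by linarith
  have "ln (exp (- ?X)) \<le> ln (gibbs_sum V S x)"
    using lb gibbs_sum_pos[OF assms(1)] by (subst ln_le_cancel_iff) auto
  moreover have "ln (gibbs_sum V S x) \<le> ln (2 ^ card V * exp ?X)"
    using ub gibbs_sum_pos[OF assms(1)] by (subst ln_le_cancel_iff) auto
  moreover have "ln (2 ^ card V * exp ?X) = card V * ln 2 + ?X"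
    by (simp add: ln_mult ln_realpow)
  moreover have "0 \<le> card V * ln (2::real)" by simp
  ultimately show ?thesis unfolding ln_exp by (intro abs_leI) linarith+
qed

lemma sum_boltzmann_normalized: "finite V \<Longrightarrow> (\<Sum>\<sigma>\<in>configs V. boltzmann S x \<sigma> / gibbs_sum V S x) = 1"
  using gibbs_sum_pos[of V S x] by (simp add: gibbs_sum_def sum_divide_distrib[symmetric])

lemma abs_corr_le_1:
  assumes "finite V" "i \<in> V" "j \<in> V"
  shows "\<bar>corr V S x i j\<bar> \<le> 1"
proof -
  have "\<bar>corr V S x i j\<bar> \<le> (\<Sum>\<sigma>\<in>configs V. \<bar>boltzmann S x \<sigma> / gibbs_sum V S x * \<sigma> i * \<sigma> j\<bar>)"
    unfolding corr_def by (rule sum_abs)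
  also have "\<dots> = (\<Sum>\<sigma>\<in>configs V. boltzmann S x \<sigma> / gibbs_sum V S x)"
    using gibbs_sum_pos[OF assms(1), of S x] assms(2,3)
    by (intro sum.cong) (auto simp: abs_mult abs_configs less_imp_le)
  also have "\<dots> = 1" by (rule sum_boltzmann_normalized[OF assms(1)])
  finally show ?thesis .
qed

lemma corr_diag:
  assumes "finite V" "i \<in> V"
  shows "corr V S x i i = 1"
proof -
  have "corr V S x i i = (\<Sum>\<sigma>\<in>configs V. boltzmann S x \<sigma> / gibbs_sum V S x)"
    unfolding corr_def using assms(2) by (intro sum.cong) (auto dest: configsD)
  then show ?thesis by (simp add: sum_boltzmann_normalized[OF assms(1)])
qed

lemma corr_commute: "corr V S x i j = corr V S x j i"
  by (simp add: corr_def mult_ac)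

text \<open>
  The correlation matrix is the Gram matrix of the spins under the Gibbs measure.
\<close>
lemma corr_power_psd:
  assumes "finite V"
  shows "0 \<le> (\<Sum>i\<in>I. \<Sum>j\<in>I. u i * u j * corr V S x i j ^ n)"
  unfolding corr_def
  using gibbs_sum_pos[OF assms, of S x]
  by (intro gram_power_nonneg[where s = "\<lambda>\<sigma>. \<sigma>"]) (auto simp: less_imp_le)

text \<open>
  Since \<open>\<sigma> i * \<sigma> j\<close> is a sign, \<open>exp (y * \<sigma> i * \<sigma> j) = cosh y + \<sigma> i * \<sigma> j * sinh y\<close>.
\<close>
lemma gibbs_sum_insert:
  assumes V: "finite V" "i \<in> V" "j \<in> V" and S: "finite S" "(i, j) \<notin> S"
  shows "gibbs_sum V (insert (i, j) S) (x((i, j) := y))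
       = gibbs_sum V S x * (cosh y + corr V S x i j * sinh y)"
proof -
  have *: "boltzmann (insert (i, j) S) (x((i, j) := y)) \<sigma>
      = boltzmann S x \<sigma> * cosh y + boltzmann S x \<sigma> * \<sigma> i * \<sigma> j * sinh y"
    if \<sigma>: "\<sigma> \<in> configs V" for \<sigma>
  proof -
    have "(\<Sum>e\<in>S. (x((i, j) := y)) e * \<sigma> (fst e) * \<sigma> (snd e)) = (\<Sum>e\<in>S. x e * \<sigma> (fst e) * \<sigma> (snd e))"
      using S by (intro sum.cong) auto
    then have "boltzmann (insert (i, j) S) (x((i, j) := y)) \<sigma> = exp (y * \<sigma> i * \<sigma> j) * boltzmann S x \<sigma>"
      using S by (simp add: boltzmann_def exp_add)
    moreover have "exp (y * \<sigma> i * \<sigma> j) = cosh y + \<sigma> i * \<sigma> j * sinh y"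
      using configsD[OF \<sigma> V(2)] configsD[OF \<sigma> V(3)]
      by (auto simp: cosh_plus_sinh cosh_minus_sinh)
    ultimately show ?thesis by (simp add: algebra_simps)
  qed
  have "gibbs_sum V S x * corr V S x i j = (\<Sum>\<sigma>\<in>configs V. boltzmann S x \<sigma> * \<sigma> i * \<sigma> j)"
    using gibbs_sum_pos[OF V(1), of S x] by (simp add: corr_def sum_distrib_left)
  moreover have "gibbs_sum V (insert (i, j) S) (x((i, j) := y))
     = gibbs_sum V S x * cosh y + (\<Sum>\<sigma>\<in>configs V. boltzmann S x \<sigma> * \<sigma> i * \<sigma> j) * sinh y"
    unfolding gibbs_sum_def
    by (simp add: * sum.distrib sum_distrib_right)
  ultimately show ?thesis by (simp add: algebra_simps)
qed

lemma ln_gibbs_sum_insert: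
  assumes "finite V" "i \<in> V" "j \<in> V" "finite S" "(i, j) \<notin> S"
  shows "ln (gibbs_sum V (insert (i, j) S) (x((i, j) := y)))
       = ln (gibbs_sum V S x) + ln (cosh y + corr V S x i j * sinh y)"
  unfolding gibbs_sum_insert[OF assms]
  by (intro ln_mult_pos gibbs_sum_pos cosh_plus_mult_sinh_pos abs_corr_le_1 assms)

text \<open>
  Without bonds between the two vertex sets, a configuration is a pair of independent ones and
  its weight is a product.
\<close>
lemma gibbs_sum_union:
  assumes V: "finite V1" "finite V2" "V1 \<inter> V2 = {}"
    and S: "finite S1" "finite S2" "S1 \<subseteq> V1 \<times> V1" "S2 \<subseteq> V2 \<times> V2"
  shows "gibbs_sum (V1 \<union> V2) (S1 \<union> S2) x = gibbs_sum V1 S1 x * gibbs_sum V2 S2 x"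
proof -
  have disj: "S1 \<inter> S2 = {}" using V S by blast
  have "gibbs_sum V1 S1 x * gibbs_sum V2 S2 x =
     (\<Sum>(a, b)\<in>configs V1 \<times> configs V2. boltzmann S1 x a * boltzmann S2 x b)"
    by (simp add: gibbs_sum_def sum_product sum.cartesian_product)
  also have "\<dots> = (\<Sum>\<sigma>\<in>configs (V1 \<union> V2). boltzmann (S1 \<union> S2) x \<sigma>)"
  proof (rule sum.reindex_bij_witness[where
        i = "\<lambda>\<sigma>. (restrict \<sigma> V1, restrict \<sigma> V2)" and j = "\<lambda>(a, b) k. if k \<in> V1 then a k else b k"], goal_cases)
    case (1 p)
    then show ?case
      using V by (auto simp: configs_def fun_eq_iff PiE_iff extensional_def)
  next
    case (2 p)
    then show ?case
      by (auto simp: configs_def PiE_iff extensional_def split: prod.splits if_splits)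
  next
    case (3 \<sigma>)
    then show ?case
      by (auto simp: configs_def fun_eq_iff PiE_iff extensional_def)
  next
    case (4 \<sigma>)
    then show ?case by (auto simp: configs_def PiE_iff extensional_def)
  next
    case (5 p)
    obtain a b where p: "p = (a, b)" by fastforce
    let ?\<sigma> = "\<lambda>k. if k \<in> V1 then a k else b k"
    have "(\<Sum>e\<in>S1. x e * a (fst e) * a (snd e)) = (\<Sum>e\<in>S1. x e * ?\<sigma> (fst e) * ?\<sigma> (snd e))"
      using S by (intro sum.cong) auto
    moreover have "(\<Sum>e\<in>S2. x e * b (fst e) * b (snd e)) = (\<Sum>e\<in>S2. x e * ?\<sigma> (fst e) * ?\<sigma> (snd e))"
      using S V by (intro sum.cong refl) (auto simp: disjoint_iff)
    ultimately show ?case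
      by (simp add: p boltzmann_def sum.union_disjoint[OF S(1,2) disj] exp_add)
  qed
  finally show ?thesis by (simp add: gibbs_sum_def)
qed

lemma gibbs_sum_image:
  assumes "inj_on \<tau> V" "S \<subseteq> V \<times> V"
  shows "gibbs_sum (\<tau> ` V) (map_prod \<tau> \<tau> ` S) x = gibbs_sum V S (x \<circ> map_prod \<tau> \<tau>)"
proof -
  have inj: "inj_on (map_prod \<tau> \<tau>) S"
    using map_prod_inj_on[OF assms(1) assms(1)] assms(2) by (rule inj_on_subset)
  show ?thesis
    unfolding gibbs_sum_def
  proof (rule sum.reindex_bij_witness[where j = "\<lambda>\<sigma>. restrict (\<sigma> \<circ> \<tau>) V"
      and i = "\<lambda>\<sigma>. restrict (\<sigma> \<circ> the_inv_into V \<tau>) (\<tau> ` V)"], goal_cases)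
    case (1 \<sigma>)
    then show ?case
      using the_inv_into_f_f[OF assms(1)]
      by (auto simp: configs_def fun_eq_iff PiE_iff extensional_def restrict_def)
  next
    case (2 \<sigma>)
    then show ?case by (auto simp: configs_def)
  next
    case (3 \<sigma>)
    then show ?case
      using the_inv_into_f_f[OF assms(1)]
      by (auto simp: configs_def fun_eq_iff PiE_iff extensional_def restrict_def)
  next
    case (4 \<sigma>)
    then show ?case
      using the_inv_into_f_f[OF assms(1)] by (auto simp: configs_def)
  next
    case (5 \<sigma>)
    have "(\<Sum>e\<in>map_prod \<tau> \<tau> ` S. x e * \<sigma> (fst e) * \<sigma> (snd e)) =
      (\<Sum>e\<in>S. (x \<circ> map_prod \<tau> \<tau>) e * restrict (\<sigma> \<circ> \<tau>) V (fst e) * restrict (\<sigma> \<circ> \<tau>) V (snd e))"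
      unfolding sum.reindex[OF inj] using assms(2) by (intro sum.cong) auto
    then show ?case by (simp add: boltzmann_def)
  qed
qed

lemma gibbs_sum_cong: "(\<And>e. e \<in> S \<Longrightarrow> x e = y e) \<Longrightarrow> gibbs_sum V S x = gibbs_sum V S y"
  unfolding gibbs_sum_def boltzmann_def by (simp cong: sum.cong)

lemma boltzmann_measurable [measurable]:
  assumes [measurable_cong]: "sets M = sets (Pi\<^sub>M S (\<lambda>_. borel))"
  shows "(\<lambda>x. boltzmann S x \<sigma>) \<in> borel_measurable M"
  unfolding boltzmann_def by measurable

lemma gibbs_sum_measurable [measurable]:
  assumes [measurable_cong]: "sets M = sets (Pi\<^sub>M S (\<lambda>_. borel))"
  shows "gibbs_sum V S \<in> borel_measurable M"
  unfolding gibbs_sum_def [abs_def] using assms by measurable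

lemma corr_measurable [measurable]:
  assumes [measurable_cong]: "sets M = sets (Pi\<^sub>M S (\<lambda>_. borel))"
  shows "(\<lambda>x. corr V S x i j) \<in> borel_measurable M"
  unfolding corr_def using assms by measurable

section \<open>Quenched averages\<close>

definition coupling_law :: "real measure \<Rightarrow> bool" where
  "coupling_law \<rho> \<longleftrightarrow> prob_space \<rho> \<and> sets \<rho> = sets borel \<and>
     distr \<rho> borel uminus = \<rho> \<and> integrable \<rho> (\<lambda>y. \<bar>y\<bar>)"

lemma coupling_lawD:
  assumes "coupling_law \<rho>"
  shows "prob_space \<rho>" "sets \<rho> = sets borel" "space \<rho> = UNIV"
    "distr \<rho> borel uminus = \<rho>" "integrable \<rho> (\<lambda>y. \<bar>y\<bar>)"
  using assms sets_eq_imp_space_eq[of \<rho> borel] by (auto simp: coupling_law_def)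

definition mean_gain :: "real measure \<Rightarrow> real \<Rightarrow> real" where
  "mean_gain \<rho> m = (\<integral>y. gain y m \<partial>\<rho>)"

definition quenched :: "'v set \<Rightarrow> ('v \<times> 'v \<Rightarrow> real measure) \<Rightarrow> ('v \<times> 'v) set \<Rightarrow> real" where
  "quenched V \<kappa> S = (\<integral>x. ln (gibbs_sum V S x) \<partial>Pi\<^sub>M S \<kappa>)"

text \<open>
  The mean effect on the log-partition function of a new bond with law \<open>\<rho>\<close> between \<open>i\<close> and \<open>j\<close>,
  on top of the bonds \<open>S\<close>. It is defined for all pairs of vertices, including \<open>i = j\<close> and pairs
  already in \<open>S\<close>: the quadratic form in \<open>edge_gain_negative_type\<close> runs over all of them for one
  and the same bond set.
\<close>
definition edge_gain ::
    "'v set \<Rightarrow> ('v \<times> 'v \<Rightarrow> real measure) \<Rightarrow> real measure \<Rightarrow> ('v \<times> 'v) set \<Rightarrow> 'v \<Rightarrow> 'v \<Rightarrow> real" where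
  "edge_gain V \<kappa> \<rho> S i j = (\<integral>x. mean_gain \<rho> (corr V S x i j) \<partial>Pi\<^sub>M S \<kappa>)"

lemma integral_nonpos:
  fixes f :: "'a \<Rightarrow> real"
  assumes "\<And>x. f x \<le> 0"
  shows "integral\<^sup>L M f \<le> 0"
  using integral_nonneg_AE[of "\<lambda>x. - f x" M] assms by simp

lemma integrable_gain:
  assumes "coupling_law \<rho>" "\<bar>m\<bar> \<le> 1"
  shows "integrable \<rho> (\<lambda>y. gain y m)"
proof (rule Bochner_Integration.integrable_bound[OF coupling_lawD(5)[OF assms(1)]])
  note [measurable_cong] = coupling_lawD(2)[OF assms(1)]
  show "(\<lambda>y. gain y m) \<in> borel_measurable \<rho>" by measurable
qed (use gain_nonneg[OF assms(2)] gain_le_abs[OF assms(2)] in auto)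

lemma mean_gain_bounds:
  assumes "coupling_law \<rho>" "\<bar>m\<bar> \<le> 1"
  shows "0 \<le> mean_gain \<rho> m" "mean_gain \<rho> m \<le> (\<integral>y. \<bar>y\<bar> \<partial>\<rho>)"
  unfolding mean_gain_def
  by (auto intro!: integral_nonneg_AE integral_mono integrable_gain coupling_lawD(5) assms
        simp: gain_nonneg[OF assms(2)] gain_le_abs[OF assms(2)])

lemma mean_gain_one [simp]: "mean_gain \<rho> 1 = 0"
  by (simp add: mean_gain_def)

lemma mean_gain_measurable [measurable]:
  assumes "coupling_law \<rho>" and [measurable]: "f \<in> borel_measurable M"
  shows "(\<lambda>x. mean_gain \<rho> (f x)) \<in> borel_measurable M"
proof -
  interpret prob_space \<rho> using coupling_lawD(1)[OF assms(1)] .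
  note [measurable_cong] = coupling_lawD(2)[OF assms(1)]
  show ?thesis unfolding mean_gain_def by measurable
qed

text \<open>
  By symmetry of \<open>\<rho>\<close> the integrand may be averaged over \<open>y\<close> and \<open>- y\<close>, which turns it into the
  gain.
\<close>
lemma integral_ln_cosh_plus_mult_sinh:
  assumes \<rho>: "coupling_law \<rho>" and m: "\<bar>m\<bar> \<le> 1"
  shows "(\<integral>y. ln (cosh y + m * sinh y) \<partial>\<rho>) = mean_gain \<rho> m"
proof -
  note [measurable_cong] = coupling_lawD(2)[OF \<rho>]
  let ?g = "\<lambda>y. ln (cosh y + m * sinh y)"
  have int: "integrable \<rho> ?g"
    by (rule Bochner_Integration.integrable_bound[OF coupling_lawD(5)[OF \<rho>]])
       (use abs_ln_cosh_plus_mult_sinh_le[OF m] in auto)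
  have g: "?g \<in> borel_measurable borel" by measurable
  have um: "uminus \<in> measurable \<rho> borel" by measurable
  have "integrable (distr \<rho> borel uminus) ?g"
    using int coupling_lawD(4)[OF \<rho>] by simp
  then have int': "integrable \<rho> (\<lambda>y. ?g (- y))"
    by (subst (asm) integrable_distr_eq[OF um g])
  have "integral\<^sup>L \<rho> ?g = integral\<^sup>L (distr \<rho> borel uminus) ?g"
    using coupling_lawD(4)[OF \<rho>] by simp
  also have "\<dots> = (\<integral>y. ?g (- y) \<partial>\<rho>)"
    by (rule integral_distr[OF um g])
  finally have sym: "integral\<^sup>L \<rho> ?g = (\<integral>y. ?g (- y) \<partial>\<rho>)" .
  have "mean_gain \<rho> m = (\<integral>y. (?g y + ?g (- y)) / 2 \<partial>\<rho>)"
    by (simp only: mean_gain_def gain_symmetrization[OF m])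
  also have "\<dots> = (integral\<^sup>L \<rho> ?g + (\<integral>y. ?g (- y) \<partial>\<rho>)) / 2"
    using int int' by simp
  finally show ?thesis using sym by simp
qed

lemma sets_PiM_coupling:
  "(\<And>e. coupling_law (\<kappa> e)) \<Longrightarrow> sets (Pi\<^sub>M S \<kappa>) = sets (Pi\<^sub>M S (\<lambda>_. borel))"
  by (intro sets_PiM_cong refl coupling_lawD(2))

lemma prob_space_PiM_coupling: "(\<And>e. coupling_law (\<kappa> e)) \<Longrightarrow> prob_space (Pi\<^sub>M S \<kappa>)"
  by (intro prob_space_PiM coupling_lawD(1))

text \<open>
  The couplings have finite first moment and dominate the logarithm through
  \<open>abs_ln_gibbs_sum_le\<close>. The couplings may live on more edges than those that are switched on.
\<close>
lemma integrable_ln_gibbs_sum: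
  assumes \<kappa>: "\<And>e. coupling_law (\<kappa> e)" and fin: "finite V" "finite T" "S \<subseteq> V \<times> V" "S \<subseteq> T"
  shows "integrable (Pi\<^sub>M T \<kappa>) (\<lambda>x. ln (gibbs_sum V S x))"
proof (rule Bochner_Integration.integrable_bound)
  interpret prob_space "Pi\<^sub>M T \<kappa>" using prob_space_PiM_coupling[OF \<kappa>] .
  note [measurable_cong] = sets_PiM_coupling[OF \<kappa>]
  have S: "finite S" "S \<subseteq> V \<times> V" using fin finite_subset by auto
  have "integrable (Pi\<^sub>M T \<kappa>) (\<lambda>x. \<bar>x e\<bar>)" if "e \<in> S" for e
  proof -
    have e: "e \<in> T" using that fin by auto
    have "integrable (distr (Pi\<^sub>M T \<kappa>) (\<kappa> e) (\<lambda>x. x e)) (\<lambda>y. \<bar>y\<bar>)"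
      using distr_PiM_component[of T \<kappa> e] coupling_lawD[OF \<kappa>] e by simp
    then show ?thesis
      by (rule integrable_distr[rotated]) (rule measurable_component_singleton[OF e])
  qed
  then show "integrable (Pi\<^sub>M T \<kappa>) (\<lambda>x. card V * ln 2 + (\<Sum>e\<in>S. \<bar>x e\<bar>))"
    by auto
  have restr: "(\<lambda>x. restrict x S) \<in> measurable (Pi\<^sub>M T \<kappa>) (Pi\<^sub>M S (\<lambda>_. borel))"
    unfolding measurable_cong_sets[OF sets_PiM_coupling[of \<kappa> T, OF \<kappa>] refl]
    by (rule measurable_restrict_subset[OF fin(4)])
  have "(\<lambda>x. ln (gibbs_sum V S (restrict x S))) \<in> borel_measurable (Pi\<^sub>M T \<kappa>)"
    using measurable_compose[OF restr gibbs_sum_measurable[OF refl]] by measurable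
  moreover have "gibbs_sum V S (restrict x S) = gibbs_sum V S x" for x
    by (intro gibbs_sum_cong) auto
  ultimately show "(\<lambda>x. ln (gibbs_sum V S x)) \<in> borel_measurable (Pi\<^sub>M T \<kappa>)"
    by simp
  show "AE x in Pi\<^sub>M T \<kappa>. norm (ln (gibbs_sum V S x)) \<le> norm (card V * ln 2 + (\<Sum>e\<in>S. \<bar>x e\<bar>))"
  proof (intro AE_I2)
    fix x
    show "norm (ln (gibbs_sum V S x)) \<le> norm (card V * ln 2 + (\<Sum>e\<in>S. \<bar>x e\<bar>))"
      using abs_ln_gibbs_sum_le[OF fin(1) S, of x] by (simp del: abs_le_iff)
  qed
qed

lemma integrable_mean_gain_corr:
  assumes \<kappa>: "\<And>e. coupling_law (\<kappa> e)" and \<rho>: "coupling_law \<rho>"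
    and V: "finite V" "i \<in> V" "j \<in> V"
  shows "integrable (Pi\<^sub>M S \<kappa>) (\<lambda>x. mean_gain \<rho> (corr V S x i j))"
proof -
  interpret prob_space "Pi\<^sub>M S \<kappa>" using prob_space_PiM_coupling[OF \<kappa>] .
  show ?thesis
    using mean_gain_bounds[OF \<rho> abs_corr_le_1[OF V]]
    by (intro integrable_const_bound[where B = "\<integral>y. \<bar>y\<bar> \<partial>\<rho>"] mean_gain_measurable[OF \<rho>]
          corr_measurable sets_PiM_coupling \<kappa>) auto
qed

lemma edge_gain_bounds:
  assumes \<kappa>: "\<And>e. coupling_law (\<kappa> e)" and \<rho>: "coupling_law \<rho>"
    and V: "finite V" "i \<in> V" "j \<in> V"
  shows "0 \<le> edge_gain V \<kappa> \<rho> S i j" "edge_gain V \<kappa> \<rho> S i j \<le> (\<integral>y. \<bar>y\<bar> \<partial>\<rho>)"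
proof -
  interpret prob_space "Pi\<^sub>M S \<kappa>" using prob_space_PiM_coupling[OF \<kappa>] .
  note b = mean_gain_bounds[OF \<rho> abs_corr_le_1[OF V]]
  show "0 \<le> edge_gain V \<kappa> \<rho> S i j"
    unfolding edge_gain_def using b by (intro integral_nonneg_AE) auto
  show "edge_gain V \<kappa> \<rho> S i j \<le> (\<integral>y. \<bar>y\<bar> \<partial>\<rho>)"
    unfolding edge_gain_def
    by (intro integral_le_const integrable_mean_gain_corr \<kappa> \<rho> V AE_I2 b)
qed

lemma edge_gain_diag: "finite V \<Longrightarrow> i \<in> V \<Longrightarrow> edge_gain V \<kappa> \<rho> S i i = 0"
  by (simp add: edge_gain_def corr_diag)

lemma edge_gain_commute: "edge_gain V \<kappa> \<rho> S i j = edge_gain V \<kappa> \<rho> S j i"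
  by (simp add: edge_gain_def corr_commute[of V S _ i j])

lemma edge_gain_negative_type:
  assumes \<kappa>: "\<And>e. coupling_law (\<kappa> e)" and \<rho>: "coupling_law \<rho>"
    and V: "finite V" and v: "(\<Sum>i\<in>V. v i) = 0"
  shows "(\<Sum>i\<in>V. \<Sum>j\<in>V. v i * v j * edge_gain V \<kappa> \<rho> S i j) \<le> 0"
proof -
  have 1: "(\<Sum>i\<in>V. \<Sum>j\<in>V. v i * v j * mean_gain \<rho> (corr V S x i j)) \<le> 0" for x
  proof -
    have int: "integrable \<rho> (\<lambda>y. gain y (corr V S x i j))" if "i \<in> V" "j \<in> V" for i j
      using that by (intro integrable_gain \<rho> abs_corr_le_1 V)
    have "(\<Sum>i\<in>V. \<Sum>j\<in>V. v i * v j * mean_gain \<rho> (corr V S x i j))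
        = (\<integral>y. (\<Sum>i\<in>V. \<Sum>j\<in>V. v i * v j * gain y (corr V S x i j)) \<partial>\<rho>)"
      unfolding mean_gain_def by (simp add: int Bochner_Integration.integral_sum)
    also have "\<dots> \<le> 0"
      using gain_negative_type[OF corr_power_psd[OF V] abs_corr_le_1[OF V] v]
      by (intro integral_nonpos) auto
    finally show ?thesis .
  qed
  have "(\<Sum>i\<in>V. \<Sum>j\<in>V. v i * v j * edge_gain V \<kappa> \<rho> S i j)
      = (\<integral>x. (\<Sum>i\<in>V. \<Sum>j\<in>V. v i * v j * mean_gain \<rho> (corr V S x i j)) \<partial>Pi\<^sub>M S \<kappa>)"
    unfolding edge_gain_def
    by (simp add: integrable_mean_gain_corr \<kappa> \<rho> V Bochner_Integration.integral_sum)
  also have "\<dots> \<le> 0"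
    using 1 by (intro integral_nonpos) auto
  finally show ?thesis .
qed

lemma quenched_empty: "finite V \<Longrightarrow> quenched V \<kappa> {} = card V * ln 2"
  by (simp add: quenched_def gibbs_sum_empty ln_realpow PiM_empty lebesgue_integral_count_space_finite)

text \<open>
  The new coupling is independent of the old ones and symmetric, so it can be integrated first,
  with the correlation under the old bonds held fixed.
\<close>
lemma quenched_insert:
  assumes \<kappa>: "\<And>e. coupling_law (\<kappa> e)"
    and V: "finite V" "i \<in> V" "j \<in> V" and S: "finite S" "S \<subseteq> V \<times> V" "(i, j) \<notin> S"
  shows "quenched V \<kappa> (insert (i, j) S) = quenched V \<kappa> S + edge_gain V \<kappa> (\<kappa> (i, j)) S i j"
proof -
  interpret product_sigma_finite \<kappa>
    by (intro product_sigma_finite.intro prob_space_imp_sigma_finite coupling_lawD(1) \<kappa>)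
  interpret K: prob_space "\<kappa> (i, j)" using coupling_lawD(1)[OF \<kappa>] .
  note [measurable_cong] = coupling_lawD(2)[OF \<kappa>]
  have "quenched V \<kappa> (insert (i, j) S) =
     (\<integral>x. (\<integral>y. ln (gibbs_sum V (insert (i, j) S) (x((i, j) := y))) \<partial>\<kappa> (i, j)) \<partial>Pi\<^sub>M S \<kappa>)"
    unfolding quenched_def using V S
    by (intro product_integral_insert integrable_ln_gibbs_sum \<kappa>) auto
  also have "\<dots> = (\<integral>x. ln (gibbs_sum V S x) + mean_gain (\<kappa> (i, j)) (corr V S x i j) \<partial>Pi\<^sub>M S \<kappa>)"
  proof (rule Bochner_Integration.integral_cong[OF refl])
    fix x
    have "integrable (\<kappa> (i, j)) (\<lambda>y. ln (cosh y + corr V S x i j * sinh y))"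
      by (rule Bochner_Integration.integrable_bound[OF coupling_lawD(5)[OF \<kappa>]])
         (use abs_ln_cosh_plus_mult_sinh_le[OF abs_corr_le_1[OF V]] in auto)
    then show "(\<integral>y. ln (gibbs_sum V (insert (i, j) S) (x((i, j) := y))) \<partial>\<kappa> (i, j))
        = ln (gibbs_sum V S x) + mean_gain (\<kappa> (i, j)) (corr V S x i j)"
      by (simp add: ln_gibbs_sum_insert[OF V S(1,3)] K.prob_space
            integral_ln_cosh_plus_mult_sinh[OF \<kappa> abs_corr_le_1[OF V]])
  qed
  also have "\<dots> = quenched V \<kappa> S + edge_gain V \<kappa> (\<kappa> (i, j)) S i j"
    unfolding quenched_def edge_gain_def using V S
    by (intro Bochner_Integration.integral_add integrable_ln_gibbs_sum integrable_mean_gain_corr \<kappa>) auto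
  finally show ?thesis .
qed

lemma thin_quenched_insert:
  assumes \<kappa>: "\<And>e. coupling_law (\<kappa> e)"
    and V: "finite V" "i \<in> V" "j \<in> V" and F: "finite F" "F \<subseteq> V \<times> V" "(i, j) \<notin> F"
  shows "thin (insert (i, j) F) p (quenched V \<kappa>) =
    thin F p (quenched V \<kappa>) + p (i, j) * thin F p (\<lambda>S. edge_gain V \<kappa> (\<kappa> (i, j)) S i j)"
proof -
  have "thin F p (\<lambda>S. quenched V \<kappa> (insert (i, j) S)) =
     thin F p (\<lambda>S. quenched V \<kappa> S + edge_gain V \<kappa> (\<kappa> (i, j)) S i j)"
    using F finite_subset[OF _ F(1)] by (intro thin_cong refl quenched_insert \<kappa> V) auto
  then show ?thesis
    using F by (simp add: thin_insert thin_add algebra_simps)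
qed

text \<open>
  One bond enters only through \<open>thin_quenched_insert\<close>, and the correlation it meets depends on
  the other bonds alone. Hence replacing its law and its retention probability costs at most the
  uniform difference of the weighted gains.
\<close>
lemma thin_quenched_swap:
  assumes \<kappa>: "\<And>e. coupling_law (\<kappa> e)" "\<And>e. coupling_law (\<kappa>' e)"
    and V: "finite V" and E: "finite E" "E \<subseteq> V \<times> V" "a \<in> E"
    and p: "\<And>e. e \<in> E \<Longrightarrow> 0 \<le> p e \<and> p e \<le> 1"
    and eq: "\<And>e. e \<in> E \<Longrightarrow> e \<noteq> a \<Longrightarrow> p' e = p e \<and> \<kappa>' e = \<kappa> e"
    and \<delta>: "\<And>m. \<bar>m\<bar> \<le> 1 \<Longrightarrow> \<bar>p a * mean_gain (\<kappa> a) m - p' a * mean_gain (\<kappa>' a) m\<bar> \<le> \<delta>"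
  shows "\<bar>thin E p (quenched V \<kappa>) - thin E p' (quenched V \<kappa>')\<bar> \<le> \<delta>"
proof -
  obtain i j where a: "a = (i, j)" by fastforce
  have ij: "i \<in> V" "j \<in> V" using E a by auto
  define F where "F = E - {a}"
  have F: "finite F" "F \<subseteq> V \<times> V" "(i, j) \<notin> F" and E_eq: "E = insert (i, j) F"
    using E a by (auto simp: F_def)
  have PiM: "Pi\<^sub>M S \<kappa>' = Pi\<^sub>M S \<kappa>" if "S \<subseteq> F" for S
    using that eq by (intro PiM_cong refl) (auto simp: F_def)
  let ?g = "\<lambda>\<rho> S. edge_gain V \<kappa> \<rho> S i j"
  have q: "thin F p' (quenched V \<kappa>') = thin F p (quenched V \<kappa>)"
    using eq by (intro thin_cong) (auto simp: quenched_def PiM F_def)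
  have g: "thin F p' (\<lambda>S. edge_gain V \<kappa>' (\<kappa>' a) S i j) = thin F p (?g (\<kappa>' a))"
    using eq by (intro thin_cong) (auto simp: edge_gain_def PiM F_def)
  have diff: "thin E p (quenched V \<kappa>) - thin E p' (quenched V \<kappa>') =
     thin F p (\<lambda>S. p a * ?g (\<kappa> a) S - p' a * ?g (\<kappa>' a) S)"
    unfolding E_eq thin_quenched_insert[OF \<kappa>(1) V ij F] thin_quenched_insert[OF \<kappa>(2) V ij F]
      thin_diff thin_cmult q g[unfolded a] a by simp
  have bnd: "\<bar>p a * ?g (\<kappa> a) S - p' a * ?g (\<kappa>' a) S\<bar> \<le> \<delta>" for S
  proof -
    interpret prob_space "Pi\<^sub>M S \<kappa>" using prob_space_PiM_coupling[OF \<kappa>(1)] .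
    note int = integrable_mean_gain_corr[OF \<kappa>(1) \<kappa>(1) V ij] integrable_mean_gain_corr[OF \<kappa>(1) \<kappa>(2) V ij]
    let ?d = "\<lambda>x. p a * mean_gain (\<kappa> a) (corr V S x i j) - p' a * mean_gain (\<kappa>' a) (corr V S x i j)"
    have "p a * ?g (\<kappa> a) S - p' a * ?g (\<kappa>' a) S = (\<integral>x. ?d x \<partial>Pi\<^sub>M S \<kappa>)"
      unfolding edge_gain_def by (simp add: int)
    moreover have "integrable (Pi\<^sub>M S \<kappa>) ?d" by (simp add: int)
    moreover have "- \<delta> \<le> ?d x" "?d x \<le> \<delta>" for x
      using \<delta>[OF abs_corr_le_1[OF V ij], of S x] by auto
    ultimately show ?thesis
      using integral_le_const[of ?d \<delta>] integral_ge_const[of ?d "-\<delta>"] by (auto intro!: abs_leI)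
  qed
  have pF: "0 \<le> p e \<and> p e \<le> 1" if "e \<in> F" for e using p that by (auto simp: F_def)
  have "thin F p (\<lambda>S. p a * ?g (\<kappa> a) S - p' a * ?g (\<kappa>' a) S) \<le> thin F p (\<lambda>_. \<delta>)"
    "thin F p (\<lambda>_. - \<delta>) \<le> thin F p (\<lambda>S. p a * ?g (\<kappa> a) S - p' a * ?g (\<kappa>' a) S)"
    using bnd pF by (auto intro!: thin_mono simp: abs_le_iff) (smt (verit))+
  then show ?thesis
    unfolding diff thin_const[OF F(1)] by (intro abs_leI) auto
qed

text \<open>
  The Lindeberg replacement argument: exchange the laws and probabilities edge by edge. It is
  used to pass from couplings that are present on every edge to rare strong couplings.
\<close>
lemma thin_quenched_compare:
  fixes \<delta> :: real
  assumes \<kappa>: "\<And>e. coupling_law (\<kappa> e)" "\<And>e. coupling_law (\<kappa>' e)"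
    and V: "finite V" and E: "finite E" "E \<subseteq> V \<times> V"
    and p: "\<And>e. e \<in> E \<Longrightarrow> 0 \<le> p e \<and> p e \<le> 1" "\<And>e. e \<in> E \<Longrightarrow> 0 \<le> p' e \<and> p' e \<le> 1"
    and \<delta>: "\<And>e m. e \<in> E \<Longrightarrow> \<bar>m\<bar> \<le> 1 \<Longrightarrow>
       \<bar>p e * mean_gain (\<kappa> e) m - p' e * mean_gain (\<kappa>' e) m\<bar> \<le> \<delta>"
  shows "\<bar>thin E p (quenched V \<kappa>) - thin E p' (quenched V \<kappa>')\<bar> \<le> card E * \<delta>"
proof -
  let ?p = "\<lambda>D e. if e \<in> D then p' e else p e" and ?\<kappa> = "\<lambda>D e. if e \<in> D then \<kappa>' e else \<kappa> e"
  have "\<bar>thin E p (quenched V \<kappa>) - thin E (?p D) (quenched V (?\<kappa> D))\<bar> \<le> card D * \<delta>"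
    if "finite D" "D \<subseteq> E" for D
    using that
  proof (induction D rule: finite_induct)
    case empty
    then show ?case by simp
  next
    case (insert a D)
    have "\<bar>thin E (?p D) (quenched V (?\<kappa> D)) -
        thin E (?p (insert a D)) (quenched V (?\<kappa> (insert a D)))\<bar> \<le> \<delta>"
      using insert \<kappa> p \<delta> by (intro thin_quenched_swap[where a = a] V E) auto
    then show ?case
      using insert by (simp add: distrib_right)
  qed
  from this[OF E(1) subset_refl] have
    "\<bar>thin E p (quenched V \<kappa>) - thin E (?p E) (quenched V (?\<kappa> E))\<bar> \<le> card E * \<delta>" .
  moreover have "thin E (?p E) (quenched V (?\<kappa> E)) = thin E p' (quenched V \<kappa>')"
  proof (intro thin_cong)
    fix S assume S: "S \<subseteq> E"
    have "Pi\<^sub>M S (?\<kappa> E) = Pi\<^sub>M S \<kappa>'" using S by (intro PiM_cong) auto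
    then show "quenched V (?\<kappa> E) S = quenched V \<kappa>' S" by (simp add: quenched_def)
  qed auto
  ultimately show ?thesis by simp
qed

section \<open>Superadditivity of the sparse model\<close>

lemma quenched_marginal:
  assumes \<kappa>: "\<And>e. coupling_law (\<kappa> e)" and fin: "finite T" "S \<subseteq> T"
  shows "(\<integral>x. ln (gibbs_sum V S x) \<partial>Pi\<^sub>M T \<kappa>) = quenched V \<kappa> S"
proof -
  interpret product_prob_space \<kappa> T
    by (intro product_prob_spaceI coupling_lawD(1) \<kappa>)
  have S: "(\<lambda>x. restrict x S) \<in> measurable (Pi\<^sub>M T \<kappa>) (Pi\<^sub>M S \<kappa>)"
    by (rule measurable_restrict_subset[OF fin(2)])
  have [measurable]: "gibbs_sum V S \<in> borel_measurable (Pi\<^sub>M S \<kappa>)"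
    by (intro gibbs_sum_measurable sets_PiM_coupling \<kappa>)
  have "quenched V \<kappa> S =
     (\<integral>x. ln (gibbs_sum V S x) \<partial>distr (Pi\<^sub>M T \<kappa>) (Pi\<^sub>M S \<kappa>) (\<lambda>x. restrict x S))"
    unfolding quenched_def using distr_restrict[OF fin(2,1)] by simp
  also have "\<dots> = (\<integral>x. ln (gibbs_sum V S (restrict x S)) \<partial>Pi\<^sub>M T \<kappa>)"
    by (rule integral_distr[OF S]) measurable
  also have "\<dots> = (\<integral>x. ln (gibbs_sum V S x) \<partial>Pi\<^sub>M T \<kappa>)"
    by (intro Bochner_Integration.integral_cong refl arg_cong[where f = ln] gibbs_sum_cong) auto
  finally show ?thesis by simp
qed

lemma quenched_union:
  assumes \<kappa>: "\<And>e. coupling_law (\<kappa> e)"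
    and V: "finite V1" "finite V2" "V1 \<inter> V2 = {}"
    and S: "finite S1" "finite S2" "S1 \<subseteq> V1 \<times> V1" "S2 \<subseteq> V2 \<times> V2"
  shows "quenched (V1 \<union> V2) \<kappa> (S1 \<union> S2) = quenched V1 \<kappa> S1 + quenched V2 \<kappa> S2"
proof -
  have "quenched (V1 \<union> V2) \<kappa> (S1 \<union> S2) =
      (\<integral>x. ln (gibbs_sum V1 S1 x) + ln (gibbs_sum V2 S2 x) \<partial>Pi\<^sub>M (S1 \<union> S2) \<kappa>)"
    unfolding quenched_def gibbs_sum_union[OF V S]
    by (simp add: ln_mult_pos gibbs_sum_pos V)
  also have "\<dots> = (\<integral>x. ln (gibbs_sum V1 S1 x) \<partial>Pi\<^sub>M (S1 \<union> S2) \<kappa>)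
      + (\<integral>x. ln (gibbs_sum V2 S2 x) \<partial>Pi\<^sub>M (S1 \<union> S2) \<kappa>)"
  proof (intro Bochner_Integration.integral_add)
  qed (use V S in \<open>auto intro!: integrable_ln_gibbs_sum \<kappa>\<close>)
  also have "\<dots> = quenched V1 \<kappa> S1 + quenched V2 \<kappa> S2"
    using S by (simp add: quenched_marginal[OF \<kappa>])
  finally show ?thesis .
qed

lemma quenched_image:
  assumes \<rho>: "coupling_law \<rho>" and \<tau>: "inj_on \<tau> V" and S: "S \<subseteq> V \<times> V"
  shows "quenched (\<tau> ` V) (\<lambda>_. \<rho>) (map_prod \<tau> \<tau> ` S) = quenched V (\<lambda>_. \<rho>) S"
proof -
  let ?\<phi> = "map_prod \<tau> \<tau>"
  have inj: "inj_on ?\<phi> S"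
    using map_prod_inj_on[OF \<tau> \<tau>] S by (rule inj_on_subset)
  have [measurable]: "gibbs_sum V S \<in> borel_measurable (Pi\<^sub>M S (\<lambda>_. \<rho>))"
    by (rule gibbs_sum_measurable, rule sets_PiM_coupling[OF \<rho>])
  have "quenched V (\<lambda>_. \<rho>) S = (\<integral>x. ln (gibbs_sum V S x)
       \<partial>distr (Pi\<^sub>M (?\<phi> ` S) (\<lambda>_. \<rho>)) (Pi\<^sub>M S (\<lambda>_. \<rho>)) (\<lambda>x. \<lambda>e\<in>S. x (?\<phi> e)))"
    unfolding quenched_def
    by (subst distr_PiM_reindex[OF coupling_lawD(1)[OF \<rho>] inj]) auto
  also have "\<dots> = (\<integral>x. ln (gibbs_sum V S (\<lambda>e\<in>S. x (?\<phi> e))) \<partial>Pi\<^sub>M (?\<phi> ` S) (\<lambda>_. \<rho>))"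
    by (rule integral_distr[OF measurable_restrict[OF measurable_component_singleton]])
       (auto intro: imageI)
  also have "\<dots> = quenched (\<tau> ` V) (\<lambda>_. \<rho>) (?\<phi> ` S)"
    unfolding quenched_def gibbs_sum_image[OF \<tau> S]
    by (intro Bochner_Integration.integral_cong refl arg_cong[where f = ln] gibbs_sum_cong) auto
  finally show ?thesis by simp
qed

definition pairs :: "'v::linorder set \<Rightarrow> ('v \<times> 'v) set" where
  "pairs V = {(i, j). i \<in> V \<and> j \<in> V \<and> i < j}"

lemma pairs_subset: "pairs V \<subseteq> V \<times> V"
  by (auto simp: pairs_def)

lemma finite_pairs [simp]: "finite V \<Longrightarrow> finite (pairs V)"
  by (rule finite_subset[OF pairs_subset]) simp

text \<open>
  Each unordered pair occurs twice in the full square and the diagonal vanishes.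
\<close>
lemma sum_pairs:
  fixes g :: "'v::linorder \<Rightarrow> 'v \<Rightarrow> real"
  assumes "finite V" and sym: "\<And>i j. g i j = g j i" and diag: "\<And>i. i \<in> V \<Longrightarrow> g i i = 0"
  shows "(\<Sum>e\<in>pairs V. g (fst e) (snd e)) = (\<Sum>i\<in>V. \<Sum>j\<in>V. g i j) / 2"
proof -
  let ?g = "\<lambda>e. g (fst e) (snd e)"
  have VV: "V \<times> V = pairs V \<union> (prod.swap ` pairs V \<union> (\<lambda>i. (i, i)) ` V)"
    by (auto simp: pairs_def image_iff)
  have "(\<Sum>i\<in>V. \<Sum>j\<in>V. g i j) = sum ?g (V \<times> V)"
    by (simp add: sum.cartesian_product case_prod_beta)
  also have "\<dots> = sum ?g (pairs V) + (sum ?g (prod.swap ` pairs V) + sum ?g ((\<lambda>i. (i, i)) ` V))"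
    unfolding VV using finite_pairs[OF assms(1)] assms(1)
    by (subst sum.union_disjoint; (subst sum.union_disjoint)?) (auto simp: pairs_def simp del: finite_pairs)
  also have "sum ?g (prod.swap ` pairs V) = sum ?g (pairs V)"
    by (subst sum.reindex) (auto simp: sym)
  also have "sum ?g ((\<lambda>i. (i, i)) ` V) = 0"
    using diag by (intro sum.neutral) auto
  finally show ?thesis by simp
qed

text \<open>
  The two random sets differ only if \<open>e\<close> is retained, an event of probability \<open>p e\<close>.
\<close>
lemma thin_delete_le:
  assumes E: "finite E" "e \<in> E" and p: "\<And>e. e \<in> E \<Longrightarrow> 0 \<le> p e \<and> p e \<le> 1"
    and g: "\<And>S. 0 \<le> g S" "\<And>S. g S \<le> L"
  shows "\<bar>thin (E - {e}) p g - thin E p g\<bar> \<le> p e * L"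
proof -
  let ?F = "E - {e}"
  have "thin E p g = (1 - p e) * thin ?F p g + p e * thin ?F p (\<lambda>S. g (insert e S))"
    using thin_insert[of ?F e p g] E by (simp add: insert_absorb)
  then have "thin ?F p g - thin E p g = p e * (thin ?F p g - thin ?F p (\<lambda>S. g (insert e S)))"
    by (simp add: algebra_simps)
  moreover have "0 \<le> thin ?F p f" "thin ?F p f \<le> L" if "\<And>S. 0 \<le> f S" "\<And>S. f S \<le> L" for f
    using thin_mono[of ?F p "\<lambda>_. 0" f] thin_mono[of ?F p f "\<lambda>_. L"] p E that
    by (auto simp: thin_const)
  then have "\<bar>thin ?F p g - thin ?F p (\<lambda>S. g (insert e S))\<bar> \<le> L"
    using g by (intro abs_leI) (smt (verit))+
  ultimately show ?thesis
    using p[OF E(2)] by (simp add: abs_mult mult_left_mono)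
qed

text \<open>
  If no bond joins the two vertex sets, the log-partition function is a sum of two terms, each
  depending on the bonds of one side.
\<close>
lemma thin_split:
  assumes \<kappa>: "\<And>e. coupling_law (\<kappa> e)"
    and V: "finite V1" "finite V2" "V1 \<inter> V2 = {}" and E: "E1 \<subseteq> V1 \<times> V1" "E2 \<subseteq> V2 \<times> V2"
  shows "thin (E1 \<union> E2) p (quenched (V1 \<union> V2) \<kappa>) =
    thin E1 p (quenched V1 \<kappa>) + thin E2 p (quenched V2 \<kappa>)"
proof -
  have fin: "finite E1" "finite E2" using E V finite_subset by blast+
  have disj: "E1 \<inter> E2 = {}" using E V by blast
  have "thin (E1 \<union> E2) p (quenched (V1 \<union> V2) \<kappa>) =
     thin (E1 \<union> E2) p (\<lambda>S. quenched V1 \<kappa> (S \<inter> E1) + quenched V2 \<kappa> (S \<inter> E2))"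
  proof (intro thin_cong refl)
    fix S assume "S \<subseteq> E1 \<union> E2"
    then have S: "S = (S \<inter> E1) \<union> (S \<inter> E2)" by auto
    show "quenched (V1 \<union> V2) \<kappa> S = quenched V1 \<kappa> (S \<inter> E1) + quenched V2 \<kappa> (S \<inter> E2)"
      by (subst S, rule quenched_union[OF \<kappa> V]) (use fin E in auto)
  qed
  also have "\<dots> = thin ((E1 \<union> E2) \<inter> E1) p (quenched V1 \<kappa>) + thin ((E1 \<union> E2) \<inter> E2) p (quenched V2 \<kappa>)"
    using fin by (simp add: thin_add thin_Int)
  also have "(E1 \<union> E2) \<inter> E1 = E1" by auto
  also have "(E1 \<union> E2) \<inter> E2 = E2" by auto
  finally show ?thesis .
qed

text \<open>
  The mean log-partition function of an Ising spin glass on the Erdos-Renyi graph with edge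
  probability \<open>c / card V\<close> and couplings of law \<open>\<rho>\<close>.
\<close>
definition sparse_energy :: "real measure \<Rightarrow> real \<Rightarrow> 'v::linorder set \<Rightarrow> real" where
  "sparse_energy \<rho> c V = thin (pairs V) (\<lambda>_. c / card V) (quenched V (\<lambda>_. \<rho>))"

text \<open>
  Interpolate linearly from the edge probability \<open>c / (n1 + n2)\<close> on all pairs at \<open>t = 0\<close> to
  \<open>c / n1\<close> and \<open>c / n2\<close> inside the two blocks and \<open>0\<close> across at \<open>t = 1\<close>. The velocity at the
  pair \<open>(i, j)\<close> is a positive multiple of \<open>v i * v j\<close> with \<open>v = 1 / n1\<close> on the first block and
  \<open>v = - 1 / n2\<close> on the second. Thus, if the effect of an edge were measured on the complete
  random graph, the derivative would be a positive multiple of a quadratic form of negative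
  type, hence at most zero. The Russo formula measures it with that edge deleted. The
  discrepancy per edge is at most speed times edge probability times the first absolute moment
  of \<open>\<rho>\<close>. Both factors are bounded by \<open>c\<close> divided by the size of a set of vertices containing
  the edge, either a block or the whole, so for each of these three sets the squares add up to
  at most \<open>c\<^sup>2\<close>.
\<close>
lemma sparse_energy_superadditive:
  fixes c :: real
  assumes \<rho>: "coupling_law \<rho>" and c: "0 < c"
    and V: "finite V1" "finite V2" "V1 \<inter> V2 = {}" and n: "c \<le> card V1" "c \<le> card V2"
  shows "sparse_energy \<rho> c V1 + sparse_energy \<rho> c V2
       \<le> sparse_energy \<rho> c (V1 \<union> V2) + 3 * c\<^sup>2 * (\<integral>y. \<bar>y\<bar> \<partial>\<rho>)"
proof -
  define V where "V = V1 \<union> V2"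
  define n1 n2 where "n1 = real (card V1)" and "n2 = real (card V2)"
  define L where "L = (\<integral>y. \<bar>y\<bar> \<partial>\<rho>)"
  have L: "0 \<le> L" unfolding L_def by (intro integral_nonneg_AE) auto
  have npos: "0 < n1" "0 < n2" "c \<le> n1" "c \<le> n2" using n c by (auto simp: n1_def n2_def)
  have cardV: "real (card V) = n1 + n2"
    using V by (simp add: V_def n1_def n2_def card_Un_disjoint)
  have finV: "finite V" using V by (simp add: V_def)
  let ?\<kappa> = "\<lambda>_ :: 'a \<times> 'a. \<rho>"
  define E where "E = pairs V"
  have E: "finite E" "E \<subseteq> V \<times> V" using finV pairs_subset by (auto simp: E_def)
  define q where "q = (\<lambda>e::'a \<times> 'a. if e \<in> V1 \<times> V1 then c / n1 else if e \<in> V2 \<times> V2 then c / n2 else 0)"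
  define p where "p = (\<lambda>t e. (1 - t) * (c / (n1 + n2)) + t * q e)"
  define g where "g = (\<lambda>(e :: 'a \<times> 'a) S. edge_gain V ?\<kappa> \<rho> S (fst e) (snd e))"
  define r where "r = (\<lambda>e::'a \<times> 'a. (if e \<in> V1 \<times> V1 then (c / n1)\<^sup>2 else 0) +
     (if e \<in> V2 \<times> V2 then (c / n2)\<^sup>2 else 0) + (c / (n1 + n2))\<^sup>2)"
  have le1: "c / (n1 + n2) \<le> c / n1" "c / (n1 + n2) \<le> c / n2"
    using npos c by (auto intro!: divide_left_mono)
  have q: "0 \<le> q e" "q e \<le> 1" for e using npos c by (auto simp: q_def)
  have c01: "0 \<le> c / (n1 + n2)" "c / (n1 + n2) \<le> 1" using npos c by auto
  have p: "0 \<le> p t e \<and> p t e \<le> 1" if "0 \<le> t" "t \<le> 1" for t e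
  proof
    show "0 \<le> p t e"
      unfolding p_def using that q c01 by (intro add_nonneg_nonneg mult_nonneg_nonneg) auto
    have "p t e \<le> (1 - t) * 1 + t * 1"
      unfolding p_def using that q c01 by (intro add_mono mult_left_mono) auto
    then show "p t e \<le> 1" by simp
  qed
  have g: "0 \<le> g e S" "g e S \<le> L" if "e \<in> E" for e S
    using edge_gain_bounds[of ?\<kappa> \<rho> V "fst e" "snd e" S] that E \<rho> finV
    by (auto simp: g_def L_def)
  \<comment> \<open>velocity times probability is at most the square of the larger endpoint of the path\<close>
  have qr: "\<bar>q e - c / (n1 + n2)\<bar> * p t e \<le> r e" if t: "0 \<le> t" "t \<le> 1" for t e
  proof -
    define s where "s = max (q e) (c / (n1 + n2))"
    have s: "0 \<le> s" using q[of e] by (simp add: s_def)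
    have 1: "\<bar>q e - c / (n1 + n2)\<bar> \<le> s" using q[of e] c01 by (auto simp: s_def)
    have "p t e \<le> (1 - t) * s + t * s"
      unfolding p_def using t by (intro add_mono mult_left_mono) (auto simp: s_def)
    then have 2: "p t e \<le> s" by (simp add: algebra_simps)
    have "\<bar>q e - c / (n1 + n2)\<bar> * p t e \<le> s * s"
      using 1 2 s p[OF t] by (intro mult_mono) auto
    also have "\<dots> \<le> r e"
      using le1 V(3) by (auto simp: s_def max_def r_def q_def power2_eq_square)
    finally show ?thesis .
  qed
  have "sum r E \<le> sum r (V \<times> V)"
    using E finV by (intro sum_mono2) (auto simp: r_def)
  also have "\<dots> = (\<Sum>e\<in>V1 \<times> V1. (c / n1)\<^sup>2) + (\<Sum>e\<in>V2 \<times> V2. (c / n2)\<^sup>2)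
      + (\<Sum>e\<in>V \<times> V. (c / (n1 + n2))\<^sup>2)"
  proof -
    have "V \<times> V \<inter> {e. e \<in> V1 \<times> V1} = V1 \<times> V1" "V \<times> V \<inter> {e. e \<in> V2 \<times> V2} = V2 \<times> V2"
      by (auto simp: V_def)
    then show ?thesis
      unfolding r_def sum.distrib using finV by (simp add: sum.If_cases)
  qed
  also have "\<dots> = 3 * c\<^sup>2"
    using npos by (simp add: card_cartesian_product cardV power2_eq_square flip: n1_def n2_def)
  finally have sum_r: "sum r E \<le> 3 * c\<^sup>2" .
  define v where "v = (\<lambda>i. if i \<in> V1 then 1 / n1 else - 1 / n2)"
  have q_v: "q e - c / (n1 + n2) = c * n1 * n2 / (n1 + n2) * (v (fst e) * v (snd e))" if "e \<in> E" for e
  proof -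
    have "fst e \<in> V2 \<longleftrightarrow> fst e \<notin> V1" "snd e \<in> V2 \<longleftrightarrow> snd e \<notin> V1"
      using that E V(3) by (auto simp: V_def)
    moreover have "c / n1 - c / (n1 + n2) = c * n1 * n2 / (n1 + n2) * (1 / n1 * (1 / n1))"
      "c / n2 - c / (n1 + n2) = c * n1 * n2 / (n1 + n2) * (- 1 / n2 * (- 1 / n2))"
      "0 - c / (n1 + n2) = c * n1 * n2 / (n1 + n2) * (1 / n1 * (- 1 / n2))"
      "0 - c / (n1 + n2) = c * n1 * n2 / (n1 + n2) * (- 1 / n2 * (1 / n1))"
      using npos c by (simp_all add: divide_simps) (simp_all add: algebra_simps)
    ultimately show ?thesis
      by (cases "fst e \<in> V1"; cases "snd e \<in> V1")
         (simp_all only: q_def v_def mem_Times_iff if_True if_False simp_thms)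
  qed
  have sum_v: "(\<Sum>i\<in>V. v i) = 0"
  proof -
    have "(\<Sum>i\<in>V2. v i) = (\<Sum>i\<in>V2. - 1 / n2)"
      using V(3) by (intro sum.cong) (auto simp: v_def)
    then show ?thesis
      using V npos by (simp add: V_def sum.union_disjoint v_def flip: n1_def n2_def)
  qed
  \<comment> \<open>the leading part of the derivative, for every realization of the bond set\<close>
  have neg: "(\<Sum>e\<in>E. (q e - c / (n1 + n2)) * g e S) \<le> 0" for S
  proof -
    have "(\<Sum>e\<in>E. (q e - c / (n1 + n2)) * g e S) =
       c * n1 * n2 / (n1 + n2) * (\<Sum>e\<in>E. v (fst e) * v (snd e) * edge_gain V ?\<kappa> \<rho> S (fst e) (snd e))"
      unfolding sum_distrib_left g_def by (intro sum.cong refl) (simp add: q_v)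
    also have "(\<Sum>e\<in>E. v (fst e) * v (snd e) * edge_gain V ?\<kappa> \<rho> S (fst e) (snd e)) =
       (\<Sum>i\<in>V. \<Sum>j\<in>V. v i * v j * edge_gain V ?\<kappa> \<rho> S i j) / 2"
      unfolding E_def
      by (rule sum_pairs[OF finV])
         (auto simp: edge_gain_diag[OF finV] edge_gain_commute[of V _ _ S] mult.commute)
    finally show ?thesis
      using edge_gain_negative_type[of ?\<kappa> \<rho> V v S] \<rho> finV sum_v npos c
      by (simp add: mult_le_0_iff divide_le_0_iff)
  qed
  let ?G = "\<lambda>t. thin E (p t) (quenched V ?\<kappa>)"
  have "?G 1 - 3 * c\<^sup>2 * L * 1 \<le> ?G 0 - 3 * c\<^sup>2 * L * 0"
  proof (rule DERIV_nonpos_imp_nonincreasing[of 0 1 "\<lambda>t. ?G t - 3 * c\<^sup>2 * L * t"])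
    fix t :: real assume t: "0 \<le> t" "t \<le> 1"
    let ?D = "\<Sum>e\<in>E. (q e - c / (n1 + n2)) *
        thin (E - {e}) (p t) (\<lambda>S. quenched V ?\<kappa> (insert e S) - quenched V ?\<kappa> S)"
    have "((\<lambda>t. (1 - t) * a + t * b) has_real_derivative (b - a)) (at t)" for a b :: real
      by (auto intro!: derivative_eq_intros)
    then have "(?G has_real_derivative ?D) (at t)"
      unfolding p_def by (intro thin_has_derivative[OF E(1)])
    then have "((\<lambda>t. ?G t - 3 * c\<^sup>2 * L * t) has_real_derivative (?D - 3 * c\<^sup>2 * L)) (at t)"
      by (auto intro!: derivative_eq_intros)
    moreover have "?D \<le> 3 * c\<^sup>2 * L"
    proof -
      have "?D = (\<Sum>e\<in>E. (q e - c / (n1 + n2)) * thin (E - {e}) (p t) (g e))"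
      proof (intro sum.cong refl arg_cong2[where f = "(*)"] thin_cong)
        fix e S assume e: "e \<in> E" and S: "S \<subseteq> E - {e}"
        obtain i j where ij: "e = (i, j)" by fastforce
        have "finite S" using S E finite_subset by blast
        then show "quenched V ?\<kappa> (insert e S) - quenched V ?\<kappa> S = g e S"
          using e S E ij by (subst ij, subst quenched_insert[OF \<rho> finV]) (auto simp: g_def)
      qed
      also have "\<dots> \<le> (\<Sum>e\<in>E. (q e - c / (n1 + n2)) * thin E (p t) (g e) + r e * L)"
      proof (intro sum_mono)
        fix e assume e: "e \<in> E"
        have "(q e - c / (n1 + n2)) * (thin (E - {e}) (p t) (g e) - thin E (p t) (g e))
           \<le> \<bar>q e - c / (n1 + n2)\<bar> * \<bar>thin (E - {e}) (p t) (g e) - thin E (p t) (g e)\<bar>"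
          by (metis abs_ge_self abs_mult)
        also have "\<dots> \<le> \<bar>q e - c / (n1 + n2)\<bar> * (p t e * L)"
          using thin_delete_le[OF E(1) e p[OF t] g[OF e]] by (intro mult_left_mono) auto
        also have "\<dots> \<le> r e * L"
          using qr[OF t, of e] L by (simp add: mult_right_mono flip: mult.assoc)
        finally show "(q e - c / (n1 + n2)) * thin (E - {e}) (p t) (g e)
           \<le> (q e - c / (n1 + n2)) * thin E (p t) (g e) + r e * L"
          by (simp add: algebra_simps)
      qed
      also have "\<dots> = thin E (p t) (\<lambda>S. \<Sum>e\<in>E. (q e - c / (n1 + n2)) * g e S) + sum r E * L"
        by (simp add: sum.distrib sum_distrib_right thin_sum thin_cmult)
      also have "\<dots> \<le> thin E (p t) (\<lambda>_. 0) + 3 * c\<^sup>2 * L"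
        using sum_r L neg p[OF t] by (intro add_mono thin_mono mult_right_mono) auto
      finally show ?thesis by (simp add: thin_const[OF E(1)])
    qed
    ultimately show "\<exists>y. ((\<lambda>t. ?G t - 3 * c\<^sup>2 * L * t) has_real_derivative y) (at t) \<and> y \<le> 0"
      by (intro exI[of _ "?D - 3 * c\<^sup>2 * L"]) auto
  qed auto
  then have main: "?G 1 \<le> ?G 0 + 3 * c\<^sup>2 * L" by simp
  have G0: "?G 0 = sparse_energy \<rho> c V"
    unfolding sparse_energy_def E_def cardV by (intro thin_cong) (auto simp: p_def)
  \<comment> \<open>at the endpoint \<open>t = 1\<close> the cross edges have probability zero and the system decouples\<close>
  have supp: "{e \<in> E. q e \<noteq> 0} = pairs V1 \<union> pairs V2"
    using npos c V(3) by (auto simp: q_def E_def pairs_def V_def split: if_splits)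
  have "?G 1 = thin (pairs V1 \<union> pairs V2) q (quenched (V1 \<union> V2) ?\<kappa>)"
    using thin_support[OF E(1), of q "quenched V ?\<kappa>"]
    by (simp add: supp p_def V_def)
  also have "\<dots> = thin (pairs V1) q (quenched V1 ?\<kappa>) + thin (pairs V2) q (quenched V2 ?\<kappa>)"
    by (rule thin_split[OF \<rho> V pairs_subset pairs_subset])
  also have "thin (pairs V1) q (quenched V1 ?\<kappa>) = sparse_energy \<rho> c V1"
    unfolding sparse_energy_def by (intro thin_cong) (auto simp: q_def n1_def pairs_def)
  also have "thin (pairs V2) q (quenched V2 ?\<kappa>) = sparse_energy \<rho> c V2"
    unfolding sparse_energy_def using V(3) by (intro thin_cong) (auto simp: q_def n2_def pairs_def)
  finally show ?thesis using main unfolding G0 by (simp add: V_def L_def)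
qed

text \<open>
  The edges are oriented along the order of the vertices, so an order-preserving relabelling
  maps edges to edges; the couplings are identically distributed and do not notice it.
\<close>
lemma sparse_energy_image:
  assumes \<rho>: "coupling_law \<rho>" and V: "finite V" and \<tau>: "strict_mono_on V \<tau>"
  shows "sparse_energy \<rho> c (\<tau> ` V) = sparse_energy \<rho> c V"
proof -
  have inj: "inj_on \<tau> V" using strict_mono_on_imp_inj_on[OF \<tau>] .
  have img: "pairs (\<tau> ` V) = map_prod \<tau> \<tau> ` pairs V"
  proof -
    have "i < j" if "i \<in> V" "j \<in> V" "\<tau> i < \<tau> j" for i j
      using strict_mono_on_less[OF \<tau> that(1,2)] that(3) by simp
    then show ?thesis
      using strict_mono_onD[OF \<tau>] by (force simp: pairs_def image_iff)
  qed
  have "inj_on (map_prod \<tau> \<tau>) (pairs V)"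
    using map_prod_inj_on[OF inj inj] pairs_subset by (rule inj_on_subset)
  then show ?thesis
    unfolding sparse_energy_def img card_image[OF inj]
    using V pairs_subset[of V]
    by (subst thin_image) (auto intro!: thin_cong quenched_image \<rho> inj)
qed

lemma sparse_energy_le:
  fixes c :: real
  assumes \<rho>: "coupling_law \<rho>" and V: "finite V" and c: "0 \<le> c" "c \<le> card V"
  shows "sparse_energy \<rho> c V \<le> card V * (ln 2 + c * (\<integral>y. \<bar>y\<bar> \<partial>\<rho>))"
proof -
  let ?L = "\<integral>y. \<bar>y\<bar> \<partial>\<rho>" and ?p = "\<lambda>_::'a \<times> 'a. c / card V" and ?\<kappa> = "\<lambda>_::'a \<times> 'a. \<rho>"
  have L: "0 \<le> ?L" by (intro integral_nonneg_AE) auto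
  have p: "0 \<le> c / card V" "c / card V \<le> 1" using c by (auto simp: divide_le_eq_1)
  have "thin F ?p (quenched V ?\<kappa>) \<le> card V * ln 2 + card F * (c / card V * ?L)"
    if "finite F" "F \<subseteq> V \<times> V" for F
    using that
  proof (induction F rule: finite_induct)
    case empty
    then show ?case by (simp add: quenched_empty[OF V])
  next
    case (insert e F)
    obtain i j where e: "e = (i, j)" by fastforce
    have ij: "i \<in> V" "j \<in> V" "(i, j) \<notin> F" "F \<subseteq> V \<times> V" using insert e by auto
    have "thin F ?p (\<lambda>S. edge_gain V ?\<kappa> \<rho> S i j) \<le> thin F ?p (\<lambda>_. ?L)"
      using p edge_gain_bounds[of ?\<kappa> \<rho> V i j] \<rho> V ij by (intro thin_mono) auto
    then have "c / card V * thin F ?p (\<lambda>S. edge_gain V ?\<kappa> \<rho> S i j) \<le> c / card V * ?L"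
      using p by (intro mult_left_mono) (auto simp: thin_const insert)
    moreover have "thin F ?p (quenched V ?\<kappa>) \<le> card V * ln 2 + card F * (c / card V * ?L)"
      using insert by auto
    ultimately have "thin F ?p (quenched V ?\<kappa>) + c / card V * thin F ?p (\<lambda>S. edge_gain V ?\<kappa> \<rho> S i j)
        \<le> card V * ln 2 + (1 + card F) * (c / card V * ?L)"
      by (simp only: distrib_right of_nat_add of_nat_1 mult_1)
    then show ?case
      using insert(1,2) thin_quenched_insert[OF \<rho> V ij(1,2) insert(1) ij(4,3), of ?p]
      by (simp add: e)
  qed
  from this[OF finite_pairs[OF V] pairs_subset]
  have "sparse_energy \<rho> c V \<le> card V * ln 2 + card (pairs V) * (c / card V * ?L)"
    by (simp add: sparse_energy_def)
  also have "card (pairs V) * (c / card V * ?L) \<le> (card V * card V) * (c / card V * ?L)"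
  proof (intro mult_right_mono)
    have "card (pairs V) \<le> card (V \<times> V)" by (intro card_mono pairs_subset) (simp add: V)
    then show "real (card (pairs V)) \<le> real (card V * card V)"
      unfolding card_cartesian_product by (simp only: of_nat_le_iff)
  qed (use p(1) L in \<open>intro mult_nonneg_nonneg\<close>)
  also have "(card V * card V) * (c / card V * ?L) = card V * (c * ?L)" by simp
  finally show ?thesis by (simp add: algebra_simps)
qed

section \<open>Limiting density of the sparse model\<close>

text \<open>
  Fekete's lemma with two relaxations: superadditivity holds from \<open>n0\<close> on and up to an additive
  constant. Subtracting \<open>\<bar>K\<bar>\<close> restores exact superadditivity, and in the division of \<open>n\<close> by \<open>m\<close>
  the remainder is taken in \<open>{m..<2 * m}\<close> so that it stays beyond \<open>n0\<close>. The limit is the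
  supremum of the slopes.
\<close>
lemma almost_superadditive_converges:
  fixes a :: "nat \<Rightarrow> real" and C K :: real
  assumes super: "\<And>m n. n0 \<le> m \<Longrightarrow> n0 \<le> n \<Longrightarrow> a m + a n \<le> a (m + n) + K"
    and bound: "\<And>n. n0 \<le> n \<Longrightarrow> a n \<le> C * n"
  shows "\<exists>L. (\<lambda>n. a n / n) \<longlonglongrightarrow> L"
proof -
  define n1 where "n1 = max 1 n0"
  define b where "b n = a n - \<bar>K\<bar>" for n
  have b_super: "b m + b n \<le> b (m + n)" if "n1 \<le> m" "n1 \<le> n" for m n
    using super[of m n] that by (simp add: b_def n1_def)
  have b_bound: "b n / n \<le> C" if "n1 \<le> n" for n
    using bound[of n] that by (simp add: b_def n1_def divide_le_eq)
  define L where "L = (SUP n\<in>{n1..}. b n / n)"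
  have bdd: "bdd_above ((\<lambda>n. b n / n) ` {n1..})"
    using b_bound by (intro bdd_aboveI[of _ C]) auto
  have le_L: "b n / n \<le> L" if "n1 \<le> n" for n
    unfolding L_def using that bdd by (intro cSUP_upper) auto
  have multi: "real q * b m + b r \<le> b (q * m + r)" if "n1 \<le> m" "n1 \<le> r" for q m r
  proof (induction q)
    case (Suc q)
    have "b m + b (q * m + r) \<le> b (m + (q * m + r))"
      using that by (intro b_super) auto
    then show ?case using Suc by (simp add: algebra_simps)
  qed simp
  have "(\<lambda>n. b n / n) \<longlonglongrightarrow> L"
  proof (rule order_tendstoI)
    fix u assume "L < u"
    show "\<forall>\<^sub>F n in sequentially. b n / n < u"
      using eventually_ge_at_top[of n1]
      by eventually_elim (use le_L \<open>L < u\<close> in fastforce)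
  next
    fix l assume "l < L"
    then obtain m where m: "n1 \<le> m" and lm: "l < b m / m"
      unfolding L_def using less_cSUP_iff[OF _ bdd] by auto
    have mpos: "0 < m" using m by (simp add: n1_def)
    define x where "x = b m / m"
    define D where "D = Min (b ` {m..<2 * m})"
    have D: "D \<le> b r" if "m \<le> r" "r < 2 * m" for r
      unfolding D_def using that by (intro Min_le) auto
    have "(\<lambda>n. x - (2 * m * \<bar>x\<bar> + \<bar>D\<bar>) / real n) \<longlonglongrightarrow> x - 0"
      by (intro tendsto_intros tendsto_divide_0[OF tendsto_const] filterlim_real_sequentially
            filterlim_at_top_imp_at_infinity)
    then have "\<forall>\<^sub>F n in sequentially. l < x - (2 * m * \<bar>x\<bar> + \<bar>D\<bar>) / real n"
      using lm by (intro order_tendstoD(1)) (auto simp: x_def)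
    then show "\<forall>\<^sub>F n in sequentially. l < b n / n"
      using eventually_ge_at_top[of m]
    proof eventually_elim
      case (elim n)
      define q r where "q = n div m - 1" and "r = m + n mod m"
      have qr: "n = q * m + r" "m \<le> r" "r < 2 * m"
      proof -
        have "1 \<le> n div m" using elim mpos by (simp add: Suc_leI div_greater_zero_iff)
        then have "q * m + m = n div m * m" by (simp add: q_def diff_mult_distrib)
        then show "n = q * m + r" unfolding r_def using div_mult_mod_eq[of n m] by linarith
      qed (use mpos in \<open>auto simp: r_def\<close>)
      have n: "0 < real n" using elim mpos by simp
      have "real n * x - (2 * m * \<bar>x\<bar> + \<bar>D\<bar>) \<le> real q * b m + b r"
      proof -
        have "real q * b m = (real n - real r) * x"
          using mpos qr(1) by (simp add: x_def field_simps)
        moreover have "real r * x \<le> 2 * m * \<bar>x\<bar>"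
        proof -
          have "real r * x \<le> real r * \<bar>x\<bar>" by (intro mult_left_mono) auto
          also have "\<dots> \<le> (2 * m) * \<bar>x\<bar>" using qr(3) by (intro mult_right_mono) auto
          finally show ?thesis by simp
        qed
        ultimately show ?thesis using D[OF qr(2,3)] by (simp add: algebra_simps)
      qed
      also have "\<dots> \<le> b n" using multi[of m r q] m qr by simp
      finally have "(real n * x - (2 * m * \<bar>x\<bar> + \<bar>D\<bar>)) / n \<le> b n / n"
        using n by (intro divide_right_mono) auto
      then have "x - (2 * m * \<bar>x\<bar> + \<bar>D\<bar>) / n \<le> b n / n"
        using n by (simp add: diff_divide_distrib)
      then show ?case using elim by linarith
    qed
  qed
  moreover have "(\<lambda>n. \<bar>K\<bar> / real n) \<longlonglongrightarrow> 0"
    by (intro tendsto_divide_0[OF tendsto_const] filterlim_real_sequentially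
            filterlim_at_top_imp_at_infinity)
  ultimately have "(\<lambda>n. b n / n + \<bar>K\<bar> / n) \<longlonglongrightarrow> L + 0" by (rule tendsto_add)
  moreover have "(\<lambda>n. b n / n + \<bar>K\<bar> / n) = (\<lambda>n. a n / n)"
    by (simp add: b_def diff_divide_distrib)
  ultimately show ?thesis by auto
qed

text \<open>
  Each approximating sequence may have its own limit; only the Cauchy property is transferred.
\<close>
lemma convergent_if_approximable:
  fixes f :: "nat \<Rightarrow> real"
  assumes "\<And>\<delta>. 0 < \<delta> \<Longrightarrow> \<exists>g. convergent g \<and> (\<forall>\<^sub>F n in sequentially. \<bar>f n - g n\<bar> \<le> \<delta>)"
  shows "convergent f"
proof (rule Cauchy_convergent, rule metric_CauchyI)
  fix e :: real assume "0 < e"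
  then obtain g where g: "convergent g" and fg: "\<forall>\<^sub>F n in sequentially. \<bar>f n - g n\<bar> \<le> e / 4"
    using assms[of "e / 4"] by auto
  obtain M1 where M1: "\<And>n. M1 \<le> n \<Longrightarrow> \<bar>f n - g n\<bar> \<le> e / 4"
    using fg by (auto simp: eventually_sequentially)
  obtain M2 where M2: "\<And>m n. M2 \<le> m \<Longrightarrow> M2 \<le> n \<Longrightarrow> dist (g m) (g n) < e / 4"
    using metric_CauchyD[OF convergent_Cauchy[OF g], of "e / 4"] \<open>0 < e\<close> by auto
  have "dist (f m) (f n) < e" if "max M1 M2 \<le> m" "max M1 M2 \<le> n" for m n
  proof -
    have "\<bar>f m - f n\<bar> \<le> \<bar>f m - g m\<bar> + \<bar>g m - g n\<bar> + \<bar>f n - g n\<bar>" by arith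
    then show ?thesis
      using M1[of m] M1[of n] M2[of m n] that \<open>0 < e\<close> by (simp add: dist_real_def)
  qed
  then show "\<exists>M. \<forall>m\<ge>M. \<forall>n\<ge>M. dist (f m) (f n) < e" by blast
qed

text \<open>
  Shifting the second block by \<open>m\<close> presents \<open>{1..m + n}\<close> as a disjoint union of copies of
  \<open>{1..m}\<close> and \<open>{1..n}\<close>. The edge probability is at most one from \<open>n = c\<close> on.
\<close>
lemma sparse_energy_density_convergent:
  assumes \<rho>: "coupling_law \<rho>" and c: "0 < c"
  shows "convergent (\<lambda>N. sparse_energy \<rho> c {1..N} / real N)"
proof -
  define n0 where "n0 = nat \<lceil>c\<rceil>"
  have n0: "c \<le> real n" if "n0 \<le> n" for n using that by (simp add: n0_def)
  have "\<exists>L. (\<lambda>N. sparse_energy \<rho> c {1..N} / real N) \<longlonglongrightarrow> L"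
  proof (rule almost_superadditive_converges[of n0])
    fix m n assume mn: "n0 \<le> m" "n0 \<le> n"
    let ?\<tau> = "\<lambda>i. i + m"
    have eq: "{1..m + n} = {1..m} \<union> ?\<tau> ` {1..n}"
      by (auto simp: image_iff)
    have shift: "sparse_energy \<rho> c (?\<tau> ` {1..n}) = sparse_energy \<rho> c {1..n}"
      by (rule sparse_energy_image[OF \<rho>]) (auto simp: strict_mono_on_def)
    have "sparse_energy \<rho> c {1..m} + sparse_energy \<rho> c (?\<tau> ` {1..n}) \<le>
        sparse_energy \<rho> c ({1..m} \<union> ?\<tau> ` {1..n}) + 3 * c\<^sup>2 * (\<integral>y. \<bar>y\<bar> \<partial>\<rho>)"
      using n0[OF mn(1)] n0[OF mn(2)]
      by (intro sparse_energy_superadditive \<rho> c) (auto simp: card_image)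
    then show "sparse_energy \<rho> c {1..m} + sparse_energy \<rho> c {1..n} \<le>
        sparse_energy \<rho> c {1..m + n} + 3 * c\<^sup>2 * (\<integral>y. \<bar>y\<bar> \<partial>\<rho>)"
      unfolding shift eq .
  next
    fix n assume "n0 \<le> n"
    then show "sparse_energy \<rho> c {1..n} \<le> (ln 2 + c * (\<integral>y. \<bar>y\<bar> \<partial>\<rho>)) * real n"
      using sparse_energy_le[OF \<rho>, of "{1..n}" c] n0[of n] c by (simp add: mult.commute)
  qed
  then show ?thesis by (auto simp: convergent_def)
qed

section \<open>Couplings with a Pareto tail\<close>

locale pareto_law =
  fixes \<mu> :: "real measure" and \<alpha> C\<^sub>0 :: real
  assumes law: "coupling_law \<mu>"
    and \<alpha>: "1 < \<alpha>" "\<alpha> < 2" and C\<^sub>0: "0 < C\<^sub>0"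
    and tail: "\<And>t. 1 < t \<Longrightarrow> measure \<mu> {y. t \<le> \<bar>y\<bar>} = C\<^sub>0 * t powr (- \<alpha>)"
begin

sublocale prob_space \<mu>
  using coupling_lawD(1)[OF law] .

lemma sets_law [measurable_cong, simp]: "sets \<mu> = sets borel"
  by (rule coupling_lawD(2)[OF law])

lemma space_law [simp]: "space \<mu> = UNIV"
  by (rule coupling_lawD(3)[OF law])

text \<open>
  The law of \<open>\<bar>y\<bar> / T\<close> beyond the level \<open>T\<close>, renormalized by \<open>T powr \<alpha>\<close>. The sign in front of
  the modulus turns the closed upper tails that are known for \<open>\<mu>\<close> into the open half-lines that
  determine a Borel measure.
\<close>
definition tail_measure :: "real \<Rightarrow> real measure" where
  "tail_measure T = distr (density \<mu> (\<lambda>y. ennreal (T powr \<alpha> * indicator {y. T \<le> \<bar>y\<bar>} y)))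
     borel (\<lambda>y. - (\<bar>y\<bar> / T))"

lemma emeasure_tail_measure:
  assumes T: "1 < T"
  shows "emeasure (tail_measure T) {x<..} =
     ennreal (if x < - 1 then C\<^sub>0 * (1 - (- x) powr (- \<alpha>)) else 0)"
proof -
  let ?A = "{y. T \<le> \<bar>y\<bar> \<and> \<bar>y\<bar> < - x * T}"
  have A[measurable]: "?A \<in> sets borel" by measurable
  have pre: "(\<lambda>y. - (\<bar>y\<bar> / T)) -` {x<..} = {y. \<bar>y\<bar> < - x * T}"
    using T by (auto simp: field_simps)
  have "emeasure (tail_measure T) {x<..} =
     emeasure (density \<mu> (\<lambda>y. ennreal (T powr \<alpha> * indicator {y. T \<le> \<bar>y\<bar>} y))) {y. \<bar>y\<bar> < - x * T}"
    unfolding tail_measure_def by (subst emeasure_distr) (auto simp: pre)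
  also have "\<dots> = (\<integral>\<^sup>+y. ennreal (T powr \<alpha> * indicator {y. T \<le> \<bar>y\<bar>} y) *
      indicator {y. \<bar>y\<bar> < - x * T} y \<partial>\<mu>)"
    by (rule emeasure_density) auto
  also have "\<dots> = (\<integral>\<^sup>+y. ennreal (T powr \<alpha>) * indicator ?A y \<partial>\<mu>)"
    by (intro nn_integral_cong) (auto simp: indicator_def)
  also have "\<dots> = ennreal (T powr \<alpha>) * emeasure \<mu> ?A"
    by (rule nn_integral_cmult_indicator) simp
  also have "\<dots> = ennreal (T powr \<alpha> * measure \<mu> ?A)"
    by (simp add: emeasure_eq_measure ennreal_mult)
  also have "T powr \<alpha> * measure \<mu> ?A = (if x < - 1 then C\<^sub>0 * (1 - (- x) powr (- \<alpha>)) else 0)"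
  proof (cases "x < - 1")
    case True
    then have xT: "T < - x * T" using T mult_strict_right_mono[of 1 "- x" T] by simp
    have eq: "?A = {y. T \<le> \<bar>y\<bar>} - {y. - x * T \<le> \<bar>y\<bar>}" by auto
    have "measure \<mu> ?A = measure \<mu> {y. T \<le> \<bar>y\<bar>} - measure \<mu> {y. - x * T \<le> \<bar>y\<bar>}"
      unfolding eq using xT by (intro finite_measure_Diff) auto
    also have "\<dots> = C\<^sub>0 * T powr (- \<alpha>) - C\<^sub>0 * ((- x) powr (- \<alpha>) * T powr (- \<alpha>))"
      using T xT True tail[of T] tail[of "- x * T"] powr_mult[of "- x" T "- \<alpha>"] by simp
    also have "\<dots> = T powr (- \<alpha>) * (C\<^sub>0 * (1 - (- x) powr (- \<alpha>)))"
      by (simp add: algebra_simps)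
    finally have "T powr \<alpha> * measure \<mu> ?A =
        (T powr \<alpha> * T powr (- \<alpha>)) * (C\<^sub>0 * (1 - (- x) powr (- \<alpha>)))"
      by (simp only: mult.assoc)
    also have "T powr \<alpha> * T powr (- \<alpha>) = 1" using T by (simp flip: powr_add)
    finally show ?thesis using True by simp
  next
    case False
    then have "- x * T \<le> 1 * T" using T by (intro mult_right_mono) auto
    then have "?A = {}" by auto
    then have "measure \<mu> ?A = 0" by (simp only: measure_empty)
    then show ?thesis using False by (simp only: mult_zero_right if_False)
  qed
  finally show ?thesis .
qed

text \<open>
  Scale invariance of the exact power law: the value on a half-line in \<open>emeasure_tail_measure\<close>
  does not involve \<open>T\<close>.
\<close>
lemma tail_measure_cong: "1 < S \<Longrightarrow> 1 < T \<Longrightarrow> tail_measure S = tail_measure T"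
  by (rule measure_eqI_lessThan)
     (simp_all only: emeasure_tail_measure, auto simp: tail_measure_def)

lemma integral_tail_measure:
  assumes [measurable]: "g \<in> borel_measurable borel" and T: "1 < T"
  shows "integral\<^sup>L (tail_measure T) g =
    T powr \<alpha> * (\<integral>y. indicator {y. T \<le> \<bar>y\<bar>} y * g (- (\<bar>y\<bar> / T)) \<partial>\<mu>)"
proof -
  have "integral\<^sup>L (tail_measure T) g =
     (\<integral>y. g (- (\<bar>y\<bar> / T)) \<partial>density \<mu> (\<lambda>y. ennreal (T powr \<alpha> * indicator {y. T \<le> \<bar>y\<bar>} y)))"
    unfolding tail_measure_def by (rule integral_distr) auto
  also have "\<dots> = (\<integral>y. (T powr \<alpha> * indicator {y. T \<le> \<bar>y\<bar>} y) *\<^sub>R g (- (\<bar>y\<bar> / T)) \<partial>\<mu>)"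
    by (rule integral_density) auto
  finally show ?thesis by (simp add: mult.assoc)
qed

lemma tail_scaling:
  assumes "g \<in> borel_measurable borel" "\<And>y. g (- y) = g y" "1 < S" "1 < T"
  shows "S powr \<alpha> * (\<integral>y. indicator {y. S \<le> \<bar>y\<bar>} y * g (y / S) \<partial>\<mu>) =
         T powr \<alpha> * (\<integral>y. indicator {y. T \<le> \<bar>y\<bar>} y * g (y / T) \<partial>\<mu>)"
proof -
  have even: "g (- (\<bar>y\<bar> / R)) = g (y / R)" for y R
    using assms(2)[of "y / R"] by (cases "0 \<le> y") (simp_all add: abs_if)
  show ?thesis
    using integral_tail_measure[OF assms(1,3)] integral_tail_measure[OF assms(1,4)]
      tail_measure_cong[OF assms(3,4)] by (simp only: even)
qed

text \<open>
  The fixed point of \<open>K + 4 * C\<^sub>0 = K * 2 powr (2 - \<alpha>)\<close>, which closes the doubling induction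
  below; it is positive because \<open>\<alpha> < 2\<close>.
\<close>
definition moment_const :: real where
  "moment_const = 4 * C\<^sub>0 / (2 powr (2 - \<alpha>) - 1)"

lemma moment_const_pos: "0 < moment_const"
  using \<alpha> C\<^sub>0 by (simp add: moment_const_def)

text \<open>
  Induction over the dyadic scale of \<open>T\<close>. Passing from \<open>T = S\<close> to \<open>T = 2 * S\<close> adds at most
  \<open>4 * S\<^sup>2\<close> times the probability of \<open>\<bar>y\<bar> \<ge> S\<close>, that is \<open>4 * C\<^sub>0 * S powr (2 - \<alpha>)\<close>; below \<open>2\<close>
  the trivial bound \<open>4\<close> serves as a start, since the tail is prescribed beyond \<open>1\<close> only.
\<close>
lemma truncated_second_moment:
  assumes "0 < T"
  shows "(\<integral>y. indicator {y. \<bar>y\<bar> < T} y * y\<^sup>2 \<partial>\<mu>) \<le> 4 + moment_const * T powr (2 - \<alpha>)"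
proof -
  let ?m = "\<lambda>T. \<integral>y. indicator {y. \<bar>y\<bar> < T} y * y\<^sup>2 \<partial>\<mu>"
  have sq: "y\<^sup>2 \<le> T\<^sup>2" if "\<bar>y\<bar> < T" for y T :: real
    using that by (intro power2_le_iff_abs_le[THEN iffD2]) auto
  have int: "integrable \<mu> (\<lambda>y. indicator {y. \<bar>y\<bar> < T} y * y\<^sup>2)" for T
    by (rule integrable_const_bound[where B = "T\<^sup>2"]) (auto simp: indicator_def sq)
  have "?m T \<le> 4 + moment_const * T powr (2 - \<alpha>)" if "0 < T" "T \<le> 2 ^ Suc n" for n T
    using that
  proof (induction n arbitrary: T)
    case 0
    have "?m T \<le> 4"
      using 0 sq[of _ 2] by (intro integral_le_const int AE_I2) (auto simp: indicator_def)
    then show ?case using moment_const_pos by (smt (verit) mult_nonneg_nonneg powr_ge_zero)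
  next
    case (Suc n)
    define S where "S = T / 2"
    show ?case
    proof (cases "T \<le> 2 ^ Suc n")
      case True
      then show ?thesis using Suc by simp
    next
      case False
      have S: "1 < S" "S \<le> 2 ^ Suc n" "T = 2 * S"
      proof -
        have "(1::real) \<le> 2 ^ n" by simp
        then show "1 < S" using False unfolding S_def power_Suc by linarith
      qed (use Suc.prems in \<open>auto simp: S_def\<close>)
      have "?m T \<le> (\<integral>y. indicator {y. \<bar>y\<bar> < S} y * y\<^sup>2 + 4 * S\<^sup>2 * indicator {y. S \<le> \<bar>y\<bar>} y \<partial>\<mu>)"
      proof (intro integral_mono)
        show "integrable \<mu> (\<lambda>y. indicator {y. \<bar>y\<bar> < S} y * y\<^sup>2 + 4 * S\<^sup>2 * indicator {y. S \<le> \<bar>y\<bar>} y)"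
          by (intro Bochner_Integration.integrable_add int integrable_mult_right integrable_real_indicator)
            (auto simp: emeasure_eq_measure)
        fix y
        show "indicator {y. \<bar>y\<bar> < T} y * y\<^sup>2 \<le> indicator {y. \<bar>y\<bar> < S} y * y\<^sup>2 + 4 * S\<^sup>2 * indicator {y. S \<le> \<bar>y\<bar>} y"
          using sq[of y T] by (auto simp: indicator_def S(3) power_mult_distrib)
      qed (rule int)
      also have "\<dots> = ?m S + 4 * S\<^sup>2 * measure \<mu> {y. S \<le> \<bar>y\<bar>}"
        using int[of S] by (subst Bochner_Integration.integral_add) (auto simp: emeasure_eq_measure)
      also have "4 * S\<^sup>2 * measure \<mu> {y. S \<le> \<bar>y\<bar>} = 4 * C\<^sub>0 * S powr (2 - \<alpha>)"
        using S(1) tail[OF S(1)] by (simp add: powr_diff powr_minus field_simps)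
      also have "?m S + 4 * C\<^sub>0 * S powr (2 - \<alpha>)
           \<le> (4 + moment_const * S powr (2 - \<alpha>)) + 4 * C\<^sub>0 * S powr (2 - \<alpha>)"
        using Suc.IH[of S] S by simp
      also have "\<dots> = 4 + (moment_const + 4 * C\<^sub>0) * S powr (2 - \<alpha>)"
        by (simp add: algebra_simps)
      also have "moment_const + 4 * C\<^sub>0 = moment_const * 2 powr (2 - \<alpha>)"
      proof -
        have "moment_const * (2 powr (2 - \<alpha>) - 1) = 4 * C\<^sub>0"
          using \<alpha> by (simp add: moment_const_def)
        then show ?thesis by (simp add: algebra_simps)
      qed
      also have "moment_const * 2 powr (2 - \<alpha>) * S powr (2 - \<alpha>) = moment_const * T powr (2 - \<alpha>)"
        using S by (simp add: powr_mult)
      finally show ?thesis .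
    qed
  qed
  moreover obtain n where n: "T < 2 ^ n" using real_arch_pow[of 2 T] by auto
  moreover have "(2::real) ^ n \<le> 2 ^ Suc n" by simp
  ultimately show ?thesis using assms by (meson less_imp_le order_trans)
qed

end

section \<open>Reduction to the sparse model\<close>

lemma coupling_law_distr:
  assumes law: "coupling_law \<mu>" and f [measurable]: "f \<in> borel_measurable borel"
    and odd: "\<And>y. f (- y) = - f y" and le: "\<And>y. \<bar>f y\<bar> \<le> B * \<bar>y\<bar>"
  shows "coupling_law (distr \<mu> borel f)"
proof -
  note [measurable_cong] = coupling_lawD(2)[OF law]
  interpret prob_space \<mu> using coupling_lawD(1)[OF law] .
  have "distr (distr \<mu> borel f) borel uminus = distr \<mu> borel (\<lambda>y. f (- y))"
    by (subst distr_distr) (auto simp: o_def odd)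
  also have "\<dots> = distr (distr \<mu> borel uminus) borel f"
    by (subst distr_distr) (auto simp: o_def)
  also have "\<dots> = distr \<mu> borel f" by (simp add: coupling_lawD(4)[OF law])
  finally have sym: "distr (distr \<mu> borel f) borel uminus = distr \<mu> borel f" .
  have "integrable \<mu> (\<lambda>y. \<bar>f y\<bar>)"
    by (rule Bochner_Integration.integrable_bound[where f = "\<lambda>y. B * \<bar>y\<bar>"])
       (use le coupling_lawD(5)[OF law] in \<open>auto intro: order_trans[OF _ abs_ge_self]\<close>)
  then have "integrable (distr \<mu> borel f) (\<lambda>y. \<bar>y\<bar>)"
    by (subst integrable_distr_eq) auto
  then show ?thesis
    using sym prob_space_distr[of f borel] by (simp add: coupling_law_def)
qed

lemma mean_gain_distr:
  assumes "coupling_law \<mu>" and [measurable]: "f \<in> borel_measurable borel"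
  shows "mean_gain (distr \<mu> borel f) m = (\<integral>y. gain (f y) m \<partial>\<mu>)"
proof -
  note [measurable_cong] = coupling_lawD(2)[OF assms(1)]
  show ?thesis unfolding mean_gain_def by (rule integral_distr) measurable
qed

context pareto_law
begin

definition coupling :: "real \<Rightarrow> nat \<Rightarrow> real measure" where
  "coupling \<beta> N = distr \<mu> borel (\<lambda>y. \<beta> / real N powr (1 / \<alpha>) * y)"

text \<open>
  For every large \<open>N\<close> the normalized coupling \<open>\<beta> * y / N powr (1 / \<alpha>)\<close>, restricted to
  \<open>\<bar>y\<bar> \<ge> \<epsilon> * N powr (1 / \<alpha>)\<close>, is distributed away from zero like this law with weight
  \<open>(2 / \<epsilon>) powr \<alpha> / N\<close>. By scale invariance it can be read off at any level above \<open>1\<close>; here the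
  level is \<open>2\<close>. The law has an atom at zero, for which the weight compensates.
\<close>
definition large_coupling :: "real \<Rightarrow> real \<Rightarrow> real measure" where
  "large_coupling \<beta> \<epsilon> = distr \<mu> borel (\<lambda>y. indicator {y. 2 \<le> \<bar>y\<bar>} y * (\<beta> * \<epsilon> / 2 * y))"

lemma coupling_law_coupling: "coupling_law (coupling \<beta> N)"
  unfolding coupling_def
  by (rule coupling_law_distr[OF law, where B = "\<bar>\<beta> / real N powr (1 / \<alpha>)\<bar>"])
     (auto simp: abs_mult)

lemma coupling_law_large_coupling: "coupling_law (large_coupling \<beta> \<epsilon>)"
  unfolding large_coupling_def
  by (rule coupling_law_distr[OF law, where B = "\<bar>\<beta> * \<epsilon> / 2\<bar>"])
     (auto simp: abs_mult indicator_def)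

text \<open>
  Split the coupling at the level \<open>T = \<epsilon> * N powr (1 / \<alpha>)\<close>. By \<open>tail_scaling\<close> the part above \<open>T\<close>
  contributes exactly the weighted gain of the large coupling. The part below \<open>T\<close> has quadratic
  gain, and its second moment is controlled by \<open>truncated_second_moment\<close>.
\<close>
lemma mean_gain_coupling_bounds:
  assumes \<epsilon>: "0 < \<epsilon>" and N: "0 < N" "1 < \<epsilon> * real N powr (1 / \<alpha>)" and m: "\<bar>m\<bar> \<le> 1"
  shows "\<bar>mean_gain (coupling \<beta> N) m
        - (2 / \<epsilon>) powr \<alpha> / N * mean_gain (large_coupling \<beta> \<epsilon>) m\<bar>
     \<le> \<beta>\<^sup>2 / 2 * (4 * real N powr (- 2 / \<alpha>) + moment_const * \<epsilon> powr (2 - \<alpha>) / N)"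
proof -
  define R where "R = real N powr (1 / \<alpha>)"
  define T where "T = \<epsilon> * R"
  have R: "0 < R" using N by (simp add: R_def)
  have T: "1 < T" "0 < T" using N by (auto simp: T_def R_def)
  define g where "g y = gain (\<beta> * \<epsilon> * y) m" for y
  have [measurable]: "g \<in> borel_measurable borel" unfolding g_def by measurable
  have g_even: "g (- y) = g y" for y by (simp add: g_def)
  have g_T: "g (y / T) = gain (\<beta> / R * y) m" for y
    using \<epsilon> by (simp add: g_def T_def)
  have int: "integrable \<mu> (\<lambda>y. gain (\<beta> / R * y) m)"
    using integrable_gain[OF coupling_law_coupling m, of \<beta> N]
    by (simp add: coupling_def integrable_distr_eq R_def)
  have int_ind: "integrable \<mu> (\<lambda>y. indicator A y * gain (\<beta> / R * y) m)" if "A \<in> sets borel" for A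
    using integrable_mult_indicator[OF _ int, of A] that by (simp only: sets_law real_scaleR_def)
  have T_powr: "T powr \<alpha> = \<epsilon> powr \<alpha> * N"
    using \<epsilon> R N \<alpha> by (simp add: T_def powr_mult R_def powr_powr)
  have "mean_gain (large_coupling \<beta> \<epsilon>) m = (\<integral>y. indicator {y. 2 \<le> \<bar>y\<bar>} y * g (y / 2) \<partial>\<mu>)"
    unfolding large_coupling_def
    by (subst mean_gain_distr[OF law])
       (auto simp: indicator_def gain_def g_def intro!: Bochner_Integration.integral_cong)
  then have "2 powr \<alpha> * mean_gain (large_coupling \<beta> \<epsilon>) m =
      T powr \<alpha> * (\<integral>y. indicator {y. T \<le> \<bar>y\<bar>} y * g (y / T) \<partial>\<mu>)"
    using tail_scaling[of g 2 T] g_even T by simp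
  then have large: "(2 / \<epsilon>) powr \<alpha> / N * mean_gain (large_coupling \<beta> \<epsilon>) m =
      (\<integral>y. indicator {y. T \<le> \<bar>y\<bar>} y * gain (\<beta> / R * y) m \<partial>\<mu>)"
    using \<epsilon> N unfolding T_powr g_T by (simp add: powr_divide field_simps)
  have "mean_gain (coupling \<beta> N) m = (\<integral>y. gain (\<beta> / R * y) m \<partial>\<mu>)"
    unfolding coupling_def R_def by (rule mean_gain_distr[OF law]) measurable
  also have "\<dots> = (\<integral>y. indicator {y. T \<le> \<bar>y\<bar>} y * gain (\<beta> / R * y) m
      + indicator {y. \<bar>y\<bar> < T} y * gain (\<beta> / R * y) m \<partial>\<mu>)"
    by (intro Bochner_Integration.integral_cong) (auto simp: indicator_def)
  also have "\<dots> = (\<integral>y. indicator {y. T \<le> \<bar>y\<bar>} y * gain (\<beta> / R * y) m \<partial>\<mu>)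
      + (\<integral>y. indicator {y. \<bar>y\<bar> < T} y * gain (\<beta> / R * y) m \<partial>\<mu>)"
    by (intro Bochner_Integration.integral_add int_ind) measurable
  finally have diff: "mean_gain (coupling \<beta> N) m - (2 / \<epsilon>) powr \<alpha> / N * mean_gain (large_coupling \<beta> \<epsilon>) m =
      (\<integral>y. indicator {y. \<bar>y\<bar> < T} y * gain (\<beta> / R * y) m \<partial>\<mu>)"
    unfolding large by simp
  have nonneg: "0 \<le> (\<integral>y. indicator {y. \<bar>y\<bar> < T} y * gain (\<beta> / R * y) m \<partial>\<mu>)"
    using gain_nonneg[OF m] by (intro integral_nonneg_AE AE_I2) auto
  have sq: "integrable \<mu> (\<lambda>y. indicator {y. \<bar>y\<bar> < T} y * y\<^sup>2)"
    using T by (intro integrable_const_bound[where B = "T\<^sup>2"])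
       (auto simp: indicator_def intro!: power2_le_iff_abs_le[THEN iffD2])
  have "(\<integral>y. indicator {y. \<bar>y\<bar> < T} y * gain (\<beta> / R * y) m \<partial>\<mu>)
      \<le> (\<integral>y. (\<beta> / R)\<^sup>2 / 2 * (indicator {y. \<bar>y\<bar> < T} y * y\<^sup>2) \<partial>\<mu>)"
  proof (intro integral_mono)
    show "integrable \<mu> (\<lambda>y. indicator {y. \<bar>y\<bar> < T} y * gain (\<beta> / R * y) m)"
      by (intro int_ind) measurable
    show "integrable \<mu> (\<lambda>y. (\<beta> / R)\<^sup>2 / 2 * (indicator {y. \<bar>y\<bar> < T} y * y\<^sup>2))"
      using sq by simp
    fix y
    have "gain (\<beta> / R * y) m \<le> (\<beta> / R)\<^sup>2 / 2 * y\<^sup>2"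
      using gain_le_square[OF m, of "\<beta> / R * y"] by (simp add: power_mult_distrib power_divide)
    then show "indicator {y. \<bar>y\<bar> < T} y * gain (\<beta> / R * y) m
        \<le> (\<beta> / R)\<^sup>2 / 2 * (indicator {y. \<bar>y\<bar> < T} y * y\<^sup>2)"
      by (simp add: indicator_def)
  qed
  also have "\<dots> = (\<beta> / R)\<^sup>2 / 2 * (\<integral>y. indicator {y. \<bar>y\<bar> < T} y * y\<^sup>2 \<partial>\<mu>)"
    by (rule integral_mult_right_zero)
  also have "\<dots> \<le> (\<beta> / R)\<^sup>2 / 2 * (4 + moment_const * T powr (2 - \<alpha>))"
    using T by (intro mult_left_mono truncated_second_moment) auto
  also have "\<dots> = \<beta>\<^sup>2 / 2 * (4 / R\<^sup>2 + moment_const * (T powr (2 - \<alpha>) / R\<^sup>2))"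
    by (simp add: power_divide algebra_simps add_divide_distrib)
  also have "4 / R\<^sup>2 = 4 * real N powr (- 2 / \<alpha>)"
  proof -
    have "R\<^sup>2 = real N powr (2 / \<alpha>)"
      using N by (simp add: R_def power2_eq_square flip: powr_add)
    then show ?thesis by (simp add: powr_minus_divide)
  qed
  also have "T powr (2 - \<alpha>) / R\<^sup>2 = \<epsilon> powr (2 - \<alpha>) / N"
  proof -
    have "T powr (2 - \<alpha>) = \<epsilon> powr (2 - \<alpha>) * (R powr 2 / R powr \<alpha>)"
      using \<epsilon> R by (simp add: T_def powr_mult powr_diff)
    also have "R powr \<alpha> = N" using N \<alpha> by (simp add: R_def powr_powr)
    also have "R powr 2 = R\<^sup>2" using R by simp
    finally show ?thesis using R by simp
  qed
  finally have upper: "(\<integral>y. indicator {y. \<bar>y\<bar> < T} y * gain (\<beta> / R * y) m \<partial>\<mu>)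
      \<le> \<beta>\<^sup>2 / 2 * (4 * real N powr (- 2 / \<alpha>) + moment_const * (\<epsilon> powr (2 - \<alpha>) / N))" .
  then show ?thesis unfolding diff using nonneg by simp
qed

text \<open>
  Replace all couplings by rare large ones. At most \<open>N\<^sup>2\<close> edges are exchanged, and each costs
  \<open>\<epsilon> powr (2 - \<alpha>) / N\<close> up to a constant and a term of smaller order in \<open>N\<close>; division by \<open>N\<close>
  leaves the asserted bound.
\<close>
lemma quenched_coupling_approx:
  assumes \<epsilon>: "0 < \<epsilon>" and N: "0 < N" "1 < \<epsilon> * real N powr (1 / \<alpha>)" "(2 / \<epsilon>) powr \<alpha> \<le> N"
  shows "\<bar>quenched {1..N} (\<lambda>_. coupling \<beta> N) (pairs {1..N}) / N
        - sparse_energy (large_coupling \<beta> \<epsilon>) ((2 / \<epsilon>) powr \<alpha>) {1..N} / N\<bar>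
     \<le> \<beta>\<^sup>2 / 2 * (4 * real N powr (1 - 2 / \<alpha>) + moment_const * \<epsilon> powr (2 - \<alpha>))"
proof -
  let ?V = "{1..N}" and ?c = "(2 / \<epsilon>) powr \<alpha>"
  define \<delta> where "\<delta> = \<beta>\<^sup>2 / 2 * (4 * real N powr (- 2 / \<alpha>) + moment_const * \<epsilon> powr (2 - \<alpha>) / N)"
  have "0 \<le> \<delta>" using moment_const_pos by (auto simp: \<delta>_def intro!: mult_nonneg_nonneg add_nonneg_nonneg)
  have fin: "finite (pairs ?V)" by simp
  have "\<bar>thin (pairs ?V) (\<lambda>_. 1) (quenched ?V (\<lambda>_. coupling \<beta> N)) -
        thin (pairs ?V) (\<lambda>_. ?c / N) (quenched ?V (\<lambda>_. large_coupling \<beta> \<epsilon>))\<bar> \<le> card (pairs ?V) * \<delta>"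
    using N mean_gain_coupling_bounds[OF \<epsilon> N(1,2)]
    by (intro thin_quenched_compare coupling_law_coupling coupling_law_large_coupling pairs_subset fin)
       (auto simp: \<delta>_def)
  also have "\<dots> \<le> (real N * real N) * \<delta>"
  proof (intro mult_right_mono \<open>0 \<le> \<delta>\<close>)
    have "card (pairs ?V) \<le> card (?V \<times> ?V)" by (intro card_mono pairs_subset) simp
    then show "real (card (pairs ?V)) \<le> real N * real N"
      by (simp add: card_cartesian_product flip: of_nat_mult)
  qed
  finally have "\<bar>quenched ?V (\<lambda>_. coupling \<beta> N) (pairs ?V)
        - sparse_energy (large_coupling \<beta> \<epsilon>) ?c ?V\<bar> \<le> real N * (real N * \<delta>)"
    by (simp add: thin_one[OF fin] sparse_energy_def del: One_nat_def)
  then have "\<bar>quenched ?V (\<lambda>_. coupling \<beta> N) (pairs ?V)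
        - sparse_energy (large_coupling \<beta> \<epsilon>) ?c ?V\<bar> / N \<le> real N * \<delta>"
    using N by (simp add: divide_le_eq mult.commute)
  also have "real N * \<delta> = \<beta>\<^sup>2 / 2 * (4 * (real N * real N powr (- 2 / \<alpha>)) + moment_const * \<epsilon> powr (2 - \<alpha>))"
    using N by (simp add: \<delta>_def algebra_simps)
  also have "real N * real N powr (- 2 / \<alpha>) = real N powr (1 - 2 / \<alpha>)"
    using N by (simp add: powr_diff powr_minus_divide)
  finally show ?thesis by (simp add: abs_divide flip: diff_divide_distrib)
qed

text \<open>
  For fixed \<open>\<epsilon>\<close> the sparse model has a limiting density, and it approximates the original
  density up to a multiple of \<open>\<epsilon> powr (2 - \<alpha>)\<close>, which is arbitrarily small because \<open>\<alpha> < 2\<close>.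
\<close>
lemma quenched_density_convergent:
  "convergent (\<lambda>N. quenched {1..N} (\<lambda>_. coupling \<beta> N) (pairs {1..N}) / real N)"
proof (rule convergent_if_approximable)
  fix \<delta> :: real assume \<delta>: "0 < \<delta>"
  \<comment> \<open>adding one keeps \<open>K\<close> positive when \<open>\<beta> = 0\<close>\<close>
  define K where "K = \<beta>\<^sup>2 * moment_const + 1"
  have K: "0 < K" using moment_const_pos by (auto simp: K_def intro!: add_nonneg_pos)
  define \<epsilon> where "\<epsilon> = (\<delta> / K) powr (1 / (2 - \<alpha>))"
  have \<epsilon>: "0 < \<epsilon>" using \<delta> K by (simp add: \<epsilon>_def)
  have \<epsilon>_powr: "\<epsilon> powr (2 - \<alpha>) = \<delta> / K"
    using \<delta> K \<alpha> by (simp add: \<epsilon>_def powr_powr)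
  have small: "\<beta>\<^sup>2 * moment_const * \<epsilon> powr (2 - \<alpha>) \<le> \<delta>"
  proof -
    have "\<beta>\<^sup>2 * moment_const * (\<delta> / K) \<le> K * (\<delta> / K)"
      using \<delta> K by (intro mult_right_mono) (auto simp: K_def)
    then show ?thesis using K by (simp add: \<epsilon>_powr)
  qed
  let ?g = "\<lambda>N. sparse_energy (large_coupling \<beta> \<epsilon>) ((2 / \<epsilon>) powr \<alpha>) {1..N} / real N"
  have "convergent ?g"
    using \<epsilon> by (intro sparse_energy_density_convergent coupling_law_large_coupling) auto
  moreover have "\<forall>\<^sub>F N in sequentially.
     \<bar>quenched {1..N} (\<lambda>_. coupling \<beta> N) (pairs {1..N}) / N - ?g N\<bar> \<le> \<delta>"
  proof -
    have "filterlim (\<lambda>N. \<epsilon> * real N powr (1 / \<alpha>)) at_top sequentially"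
      using \<epsilon> \<alpha> by real_asymp
    then have ev1: "\<forall>\<^sub>F N in sequentially. 1 < \<epsilon> * real N powr (1 / \<alpha>)"
      by (simp add: filterlim_at_top_dense)
    have ev2: "\<forall>\<^sub>F N in sequentially. (2 / \<epsilon>) powr \<alpha> \<le> real N"
      using filterlim_real_sequentially by (simp add: filterlim_at_top)
    have "(\<lambda>N. \<beta>\<^sup>2 * 2 * real N powr (1 - 2 / \<alpha>)) \<longlonglongrightarrow> \<beta>\<^sup>2 * 2 * 0"
      using \<alpha> by (intro tendsto_mult tendsto_const tendsto_neg_powr filterlim_real_sequentially) auto
    then have ev3: "\<forall>\<^sub>F N in sequentially. \<beta>\<^sup>2 * 2 * real N powr (1 - 2 / \<alpha>) < \<delta> / 2"
      using \<delta> by (intro order_tendstoD(2)) auto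
    show ?thesis
      using ev1 ev2 ev3 eventually_gt_at_top[of 0]
    proof eventually_elim
      case (elim N)
      have "\<bar>quenched {1..N} (\<lambda>_. coupling \<beta> N) (pairs {1..N}) / N - ?g N\<bar>
         \<le> \<beta>\<^sup>2 / 2 * (4 * real N powr (1 - 2 / \<alpha>) + moment_const * \<epsilon> powr (2 - \<alpha>))"
        using elim by (intro quenched_coupling_approx \<epsilon>)
      also have "\<dots> = \<beta>\<^sup>2 * 2 * real N powr (1 - 2 / \<alpha>) + \<beta>\<^sup>2 * moment_const * \<epsilon> powr (2 - \<alpha>) / 2"
        by (simp add: algebra_simps)
      finally show ?case using elim small by linarith
    qed
  qed
  ultimately show "\<exists>g. convergent g \<and> (\<forall>\<^sub>F N in sequentially.
     \<bar>quenched {1..N} (\<lambda>_. coupling \<beta> N) (pairs {1..N}) / N - g N\<bar> \<le> \<delta>)"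
    by blast
qed

end

section \<open>The free energy\<close>

text \<open>
  Independence identifies the joint law of the couplings with a product measure. Two vertices
  are required for the set of edges to be nonempty.
\<close>
lemma free_energy_eq_quenched:
  fixes M :: "'b measure" and J :: "nat \<times> nat \<Rightarrow> 'b \<Rightarrow> real"
  assumes M: "prob_space M" and N: "2 \<le> N"
    and indep: "prob_space.indep_vars M (\<lambda>_. borel) J (edges N)"
    and distr: "\<And>e. e \<in> edges N \<Longrightarrow> distr M borel (J e) = \<mu>"
  shows "free_energy \<alpha> N M J \<beta> =
    quenched {1..N} (\<lambda>_. distr \<mu> borel (\<lambda>y. \<beta> / real N powr (1 / \<alpha>) * y)) (pairs {1..N}) / N"
proof -
  interpret prob_space M by fact
  let ?b = "\<beta> / real N powr (1 / \<alpha>)" and ?\<kappa> = "distr \<mu> borel (\<lambda>y. \<beta> / real N powr (1 / \<alpha>) * y)"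
  have E: "edges N = pairs {1..N}" by (auto simp: edges_def pairs_def)
  have "(1, 2) \<in> edges N" using N by (auto simp: edges_def)
  then have ne: "edges N \<noteq> {}" by blast
  let ?X = "\<lambda>e \<omega>. ?b * J e \<omega>"
  have J[measurable]: "J e \<in> borel_measurable M" if "e \<in> edges N" for e
    using indep that unfolding indep_vars_def by auto
  have "indep_vars (\<lambda>_. borel) (\<lambda>e. (\<lambda>y. ?b * y) \<circ> J e) (edges N)"
    by (rule indep_vars_compose[OF indep]) auto
  then have "indep_vars (\<lambda>_. borel) ?X (edges N)" by (simp add: o_def)
  then have "distr M (Pi\<^sub>M (edges N) (\<lambda>_. borel)) (\<lambda>\<omega>. \<lambda>e\<in>edges N. ?X e \<omega>)
      = Pi\<^sub>M (edges N) (\<lambda>e. distr M borel (?X e))"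
    using J by (subst (asm) indep_vars_iff_distr_eq_PiM'[OF ne]) auto
  also have "\<dots> = Pi\<^sub>M (edges N) (\<lambda>_. ?\<kappa>)"
  proof (intro PiM_cong refl)
    fix e assume e: "e \<in> edges N"
    have "?\<kappa> = distr (distr M borel (J e)) borel (\<lambda>y. ?b * y)" by (simp add: distr[OF e])
    also have "\<dots> = distr M borel (?X e)"
      using J[OF e] by (subst distr_distr) (auto simp: o_def)
    finally show "distr M borel (?X e) = ?\<kappa>" by simp
  qed
  finally have dist: "distr M (Pi\<^sub>M (edges N) (\<lambda>_. borel)) (\<lambda>\<omega>. \<lambda>e\<in>edges N. ?X e \<omega>)
      = Pi\<^sub>M (edges N) (\<lambda>_. ?\<kappa>)" .
  have Z: "partition_function \<alpha> N (\<lambda>e. J e \<omega>) \<beta> =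
      gibbs_sum {1..N} (edges N) (\<lambda>e\<in>edges N. ?X e \<omega>)" for \<omega>
    unfolding partition_function_def hamiltonian_def gibbs_sum_def boltzmann_def spins_def configs_def
    by (intro sum.cong refl arg_cong[where f = exp])
       (auto simp: sum_distrib_left case_prod_beta intro!: sum.cong)
  have [measurable]: "gibbs_sum {1..N} (edges N) \<in> borel_measurable (Pi\<^sub>M (edges N) (\<lambda>_. borel))"
    by (rule gibbs_sum_measurable) simp
  have meas: "(\<lambda>\<omega>. \<lambda>e\<in>edges N. ?X e \<omega>) \<in> measurable M (Pi\<^sub>M (edges N) (\<lambda>_. borel))"
    by (intro measurable_restrict borel_measurable_times borel_measurable_const J)
  have "(\<integral>\<omega>. ln (partition_function \<alpha> N (\<lambda>e. J e \<omega>) \<beta>) \<partial>M) =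
     (\<integral>x. ln (gibbs_sum {1..N} (edges N) x)
        \<partial>distr M (Pi\<^sub>M (edges N) (\<lambda>_. borel)) (\<lambda>\<omega>. \<lambda>e\<in>edges N. ?X e \<omega>))"
    unfolding Z by (rule integral_distr[OF meas, symmetric]) measurable
  also have "\<dots> = quenched {1..N} (\<lambda>_. ?\<kappa>) (pairs {1..N})"
    unfolding dist unfolding quenched_def E ..
  finally show ?thesis by (simp add: free_energy_def)
qed

theorem theorem1p1:
  fixes \<alpha> C\<^sub>0 :: real
    and M\<^sub>0 :: "'a measure" and J\<^sub>0 :: "'a \<Rightarrow> real"
    and M :: "nat \<Rightarrow> 'b measure" and J :: "nat \<Rightarrow> nat \<times> nat \<Rightarrow> 'b \<Rightarrow> real"
  assumes "1 < \<alpha>" and "\<alpha> < 2"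
    and "prob_space M\<^sub>0" and "J\<^sub>0 \<in> borel_measurable M\<^sub>0"
    and "symmetric_rv M\<^sub>0 J\<^sub>0"
    and "integrable M\<^sub>0 (\<lambda>\<omega>. \<bar>J\<^sub>0 \<omega>\<bar>)"
    and "C\<^sub>0 > 0"
    and "\<And>t. t > 1 \<Longrightarrow> measure M\<^sub>0 {\<omega> \<in> space M\<^sub>0. \<bar>J\<^sub>0 \<omega>\<bar> \<ge> t} = C\<^sub>0 * t powr (- \<alpha>)"
    and "\<And>N. prob_space (M N)"
    and "\<And>N. prob_space.indep_vars (M N) (\<lambda>_. borel) (J N) (edges N)"
    and "\<And>N e. e \<in> edges N \<Longrightarrow> distr (M N) borel (J N e) = distr M\<^sub>0 borel J\<^sub>0"
  shows "\<forall>\<beta>>0. \<exists>L::real. (\<lambda>N. free_energy \<alpha> N (M N) (J N) \<beta>) \<longlonglongrightarrow> L"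
proof (intro allI impI)
  fix \<beta> :: real
  define \<mu> where "\<mu> = distr M\<^sub>0 borel J\<^sub>0"
  note [measurable] = assms(4)
  interpret pareto_law \<mu> \<alpha> C\<^sub>0
  proof
    have "distr \<mu> borel uminus = \<mu>"
      using assms(5) unfolding \<mu>_def symmetric_rv_def by (subst distr_distr) (auto simp: o_def)
    moreover have "integrable \<mu> (\<lambda>y. \<bar>y\<bar>)"
      unfolding \<mu>_def using assms(6) by (subst integrable_distr_eq) auto
    moreover have "prob_space \<mu>"
      unfolding \<mu>_def by (rule prob_space.prob_space_distr[OF assms(3,4)])
    ultimately show "coupling_law \<mu>" by (simp add: coupling_law_def \<mu>_def)
    fix t :: real assume "1 < t"
    moreover have "J\<^sub>0 -` {y. t \<le> \<bar>y\<bar>} \<inter> space M\<^sub>0 = {\<omega> \<in> space M\<^sub>0. t \<le> \<bar>J\<^sub>0 \<omega>\<bar>}" by auto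
    ultimately show "measure \<mu> {y. t \<le> \<bar>y\<bar>} = C\<^sub>0 * t powr - \<alpha>"
      using assms(8)[of t] unfolding \<mu>_def by (subst measure_distr) auto
  qed (use assms in auto)
  obtain L where "(\<lambda>N. quenched {1..N} (\<lambda>_. coupling \<beta> N) (pairs {1..N}) / real N) \<longlonglongrightarrow> L"
    using quenched_density_convergent[of \<beta>] by (auto simp: convergent_def)
  moreover have "\<forall>\<^sub>F N in sequentially.
     quenched {1..N} (\<lambda>_. coupling \<beta> N) (pairs {1..N}) / real N = free_energy \<alpha> N (M N) (J N) \<beta>"
    using eventually_ge_at_top[of 2]
  proof eventually_elim
    case (elim N)
    show ?case
      unfolding coupling_def
      by (rule free_energy_eq_quenched[symmetric, OF assms(9) elim assms(10)])
         (simp add: assms(11) \<mu>_def)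
  qed
  ultimately show "\<exists>L. (\<lambda>N. free_energy \<alpha> N (M N) (J N) \<beta>) \<longlonglongrightarrow> L"
    by (blast intro: Lim_transform_eventually)
qed

end
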